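(* Let $\Pi$ be a polar space or a thin polar space of rank $n$ and let $\Pi'$ be a polar space of the same rank $n$. Then every isometric embedding of $\Gamma_{n-2}(\Pi)$ in $\Gamma_{n-2}(\Pi')$ is induced by a collinearity preserving injection of $\Pi$ to $\Pi'$.
   Context: A partial linear space is a pair $(P,\mathcal{L})$ where $P$ is a non-empty set (points) and $\mathcal{L}$ is a family of proper subsets of $P$ (lines), each line has at least two points, every point lies on some line, and two distinct points lie on at most one line; distinct points on a common line are collinear. A subspace is a set containing the line through any two of its collinear points; it is singular if any two distinct points of it are collinear. A polar space is a partial linear space such that (P1) every line has at least three points, (P2) no point is collinear to all points, (P3) each point is collinear to one or to all points of each line, (P4) every chain of mutually distinct incident singular subspaces is finite. All maximal singular subspaces are projective spaces of the same dimension $n-1$ ($n\ge2$), $n$ being the rank. A thin polar space of rank $n$ is a partial linear space isomorphic to the one with point set $\{\pm1,\dots,\pm n\}$ whose lines are the sets $\{i,j\}$ with $j\ne -i$; singular subspaces are subsets containing no pair $\{i,-i\}$, of dimension $|S|-1$. $\mathcal{G}_{n-2}(\Pi)$ is the set of $(n-2)$-dimensional singular subspaces, and $\Gamma_{n-2}(\Pi)$ is the graph on $\mathcal{G}_{n-2}(\Pi)$ in which two distinct vertices are adjacent iff they are contained in a common $(n-1)$-dimensional (i.e. maximal) singular subspace. An isometric embedding of graphs is an injection of vertex sets preserving path distance. A collinearity preserving injection $h$ of $\Pi=(P,\mathcal{L})$ to $\Pi'=(P',\mathcal{L}')$ is an injection $h:P\to P'$ such that distinct $p,q$ are collinear in $\Pi$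 iff $h(p),h(q)$ are collinear in $\Pi'$. A map $f:\mathcal{G}_{n-2}(\Pi)\to\mathcal{G}_{n-2}(\Pi')$ is induced by $h$ if $f(U)$ is the singular subspace of $\Pi'$ spanned by $h(U)$ for every $U$. *)

theory Defs
  imports Main "HOL-Library.Extended_Nat"
begin

text \<open>A point-line geometry is given by a set \<open>P\<close> of points and a set \<open>L\<close> of lines,
  each line being a set of points.\<close>

definition partial_linear_space :: "'a set \<Rightarrow> 'a set set \<Rightarrow> bool" where
  "partial_linear_space P L \<longleftrightarrow>
     P \<noteq> {} \<and>
     (\<forall>l\<in>L. l \<subset> P) \<and>
     (\<forall>l\<in>L. \<exists>p\<in>l. \<exists>q\<in>l. p \<noteq> q) \<and>
     (\<forall>p\<in>P. \<exists>l\<in>L. p \<in> l) \<and>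
     (\<forall>p\<in>P. \<forall>q\<in>P. p \<noteq> q \<longrightarrow>
        (\<forall>l\<in>L. \<forall>m\<in>L. p \<in> l \<and> q \<in> l \<and> p \<in> m \<and> q \<in> m \<longrightarrow> l = m))"

text \<open>Since every point lies on a line, each point is collinear to itself. The axioms in
  \<open>polar_space\<close> below have to be read with this convention: for an irreflexive relation it
  would be trivial that no point is collinear to all points.\<close>

definition pls_collinear :: "'a set set \<Rightarrow> 'a \<Rightarrow> 'a \<Rightarrow> bool" where
  "pls_collinear L p q \<longleftrightarrow> (\<exists>l\<in>L. p \<in> l \<and> q \<in> l)"

definition pls_subspace :: "'a set \<Rightarrow> 'a set set \<Rightarrow> 'a set \<Rightarrow> bool" where
  "pls_subspace P L S \<longleftrightarrow>
     S \<subseteq> P \<and>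
     (\<forall>p\<in>S. \<forall>q\<in>S. p \<noteq> q \<longrightarrow> (\<forall>l\<in>L. p \<in> l \<and> q \<in> l \<longrightarrow> l \<subseteq> S))"

definition singular_subspace :: "'a set \<Rightarrow> 'a set set \<Rightarrow> 'a set \<Rightarrow> bool" where
  "singular_subspace P L S \<longleftrightarrow>
     pls_subspace P L S \<and> (\<forall>p\<in>S. \<forall>q\<in>S. p \<noteq> q \<longrightarrow> pls_collinear L p q)"

definition maximal_singular_subspace :: "'a set \<Rightarrow> 'a set set \<Rightarrow> 'a set \<Rightarrow> bool" where
  "maximal_singular_subspace P L M \<longleftrightarrow>
     singular_subspace P L M \<and>
     (\<forall>S. singular_subspace P L S \<and> M \<subseteq> S \<longrightarrow> S = M)"

definition pls_span :: "'a set \<Rightarrow> 'a set set \<Rightarrow> 'a set \<Rightarrow> 'a set" where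
  "pls_span P L X = \<Inter>{S. pls_subspace P L S \<and> X \<subseteq> S}"

definition pls_independent :: "'a set \<Rightarrow> 'a set set \<Rightarrow> 'a set \<Rightarrow> bool" where
  "pls_independent P L X \<longleftrightarrow>
     X \<subseteq> P \<and> (\<forall>Y. Y \<subset> X \<longrightarrow> pls_span P L Y \<noteq> pls_span P L X)"

text \<open>Projective dimension: one less than the size of a base, that is, of an independent
  spanning set. If all lines have two points, every subset of a singular subspace spans only
  itself, so that the dimension of a finite singular subspace \<open>S\<close> is \<open>card S - 1\<close>.\<close>

definition singular_subspace_of_dim ::
    "'a set \<Rightarrow> 'a set set \<Rightarrow> nat \<Rightarrow> 'a set \<Rightarrow> bool" where
  "singular_subspace_of_dim P L k S \<longleftrightarrow>
     singular_subspace P L S \<and>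
     (\<exists>B. finite B \<and> card B = k + 1 \<and> pls_independent P L B \<and> pls_span P L B = S)"

definition polar_space :: "'a set \<Rightarrow> 'a set set \<Rightarrow> bool" where
  "polar_space P L \<longleftrightarrow>
     partial_linear_space P L \<and>
     (\<forall>l\<in>L. \<exists>p\<in>l. \<exists>q\<in>l. \<exists>r\<in>l. p \<noteq> q \<and> p \<noteq> r \<and> q \<noteq> r) \<and>
     \<not> (\<exists>p\<in>P. \<forall>q\<in>P. pls_collinear L p q) \<and>
     (\<forall>p\<in>P. \<forall>l\<in>L. (\<exists>!q. q \<in> l \<and> pls_collinear L p q) \<or> (\<forall>q\<in>l. pls_collinear L p q)) \<and>
     (\<forall>C. subset.chain {S. singular_subspace P L S} C \<longrightarrow> finite C)"

definition polar_space_of_rank :: "'a set \<Rightarrow> 'a set set \<Rightarrow> nat \<Rightarrow> bool" where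
  "polar_space_of_rank P L n \<longleftrightarrow>
     polar_space P L \<and>
     (\<forall>M. maximal_singular_subspace P L M \<longrightarrow> singular_subspace_of_dim P L (n - 1) M)"

definition pls_isomorphic ::
    "'a set \<Rightarrow> 'a set set \<Rightarrow> 'b set \<Rightarrow> 'b set set \<Rightarrow> bool" where
  "pls_isomorphic P L P' L' \<longleftrightarrow> (\<exists>\<phi>. bij_betw \<phi> P P' \<and> (\<lambda>l. \<phi> ` l) ` L = L')"

definition thin_points :: "nat \<Rightarrow> int set" where
  "thin_points n = {i. 1 \<le> \<bar>i\<bar> \<and> \<bar>i\<bar> \<le> int n}"

definition thin_lines :: "nat \<Rightarrow> int set set" where
  "thin_lines n = {{i, j} |i j. i \<in> thin_points n \<and> j \<in> thin_points n \<and> i \<noteq> j \<and> j \<noteq> - i}"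

definition thin_polar_space_of_rank :: "'a set \<Rightarrow> 'a set set \<Rightarrow> nat \<Rightarrow> bool" where
  "thin_polar_space_of_rank P L n \<longleftrightarrow>
     partial_linear_space P L \<and> pls_isomorphic (thin_points n) (thin_lines n) P L"

text \<open>A simple graph is given by its vertex set \<open>V\<close> and its (symmetric) adjacency relation
  \<open>E \<subseteq> V \<times> V\<close>. A pair in \<open>E ^^ k\<close> is joined by a walk with \<open>k\<close> edges; the distance is
  \<open>\<infinity>\<close> if there is no walk.\<close>

definition graph_dist :: "('v \<times> 'v) set \<Rightarrow> 'v \<Rightarrow> 'v \<Rightarrow> enat" where
  "graph_dist E x y = (INF k\<in>{k. (x, y) \<in> E ^^ k}. enat k)"

definition isometric_embedding ::
    "'v set \<Rightarrow> ('v \<times> 'v) set \<Rightarrow> 'w set \<Rightarrow> ('w \<times> 'w) set \<Rightarrow> ('v \<Rightarrow> 'w) \<Rightarrow> bool" where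
  "isometric_embedding V E V' E' f \<longleftrightarrow>
     f ` V \<subseteq> V' \<and> inj_on f V \<and>
     (\<forall>x\<in>V. \<forall>y\<in>V. graph_dist E' (f x) (f y) = graph_dist E x y)"

definition polar_grassmannian :: "'a set \<Rightarrow> 'a set set \<Rightarrow> nat \<Rightarrow> 'a set set" where
  "polar_grassmannian P L k = {S. singular_subspace_of_dim P L k S}"

text \<open>The adjacency relation of the graph on the singular subspaces of dimension \<open>n - 2\<close>
  (used only for \<open>n \<ge> 2\<close>).\<close>

definition polar_grassmann_adj :: "'a set \<Rightarrow> 'a set set \<Rightarrow> nat \<Rightarrow> ('a set \<times> 'a set) set" where
  "polar_grassmann_adj P L n =
     {(S, T). S \<in> polar_grassmannian P L (n - 2) \<and> T \<in> polar_grassmannian P L (n - 2) \<and>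
              S \<noteq> T \<and> (\<exists>M \<in> polar_grassmannian P L (n - 1). S \<subseteq> M \<and> T \<subseteq> M)}"

definition collinearity_preserving_injection ::
    "'a set \<Rightarrow> 'a set set \<Rightarrow> 'b set \<Rightarrow> 'b set set \<Rightarrow> ('a \<Rightarrow> 'b) \<Rightarrow> bool" where
  "collinearity_preserving_injection P L P' L' h \<longleftrightarrow>
     h ` P \<subseteq> P' \<and> inj_on h P \<and>
     (\<forall>p\<in>P. \<forall>q\<in>P. p \<noteq> q \<longrightarrow> pls_collinear L p q = pls_collinear L' (h p) (h q))"

definition induced_by ::
    "'a set set \<Rightarrow> 'b set \<Rightarrow> 'b set set \<Rightarrow> ('a set \<Rightarrow> 'b set) \<Rightarrow> ('a \<Rightarrow> 'b) \<Rightarrow> bool" where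
  "induced_by V P' L' f h \<longleftrightarrow> (\<forall>U\<in>V. f U = pls_span P' L' (h ` U))"

end

theory Submission
  imports Defs
begin

text \<open>Call an \<open>(n - 2)\<close>-dimensional singular subspace submaximal. Two submaximal subspaces
  \<open>S\<close> and \<open>T\<close> are at distance at most \<open>n - 1\<close> iff some point of \<open>S\<close> is collinear with all of \<open>T\<close>,
  so this relation is preserved by the embedding \<open>f\<close> in both directions. Moreover \<open>f\<close> sends the
  submaximal subspaces of a maximal \<open>M\<close> into a single maximal \<open>g M\<close>.

  Let \<open>p \<in> M\<close>, let \<open>N\<close> be a maximal subspace disjoint from \<open>M\<close>, and let \<open>T\<close> be the set of points
  of \<open>N\<close> collinear with \<open>p\<close>. Then \<open>p\<close> is the only point of \<open>M\<close> collinear with all of \<open>T\<close>. Since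
  \<open>g M\<close> and \<open>g N\<close> are again disjoint, there is a unique point \<open>x\<close> of \<open>g M\<close> collinear with all of
  \<open>f T\<close>, and \<open>x \<in> f S\<close> iff \<open>p \<in> S\<close> for all submaximal \<open>S \<subseteq> M\<close>. This condition determines \<open>x\<close>, and
  quadrangles in the graph show that \<open>x\<close> is the same for adjacent maximal subspaces through \<open>p\<close>,
  hence for all of them. Put \<open>h p = x\<close>.

  Thin and non-thin polar spaces are treated at once by allowing lines with two points. The
  dimension theory rests on the fact that a singular subspace consists of the points collinear
  with every point that is collinear with all of it; this yields the exchange property.\<close>

section \<open>Spans, and walks of bounded length\<close>

lemma pls_span_superset: "X \<subseteq> pls_span P L X"
  by (auto simp: pls_span_def)

lemma pls_span_least: "pls_subspace P L S \<Longrightarrow> X \<subseteq> S \<Longrightarrow> pls_span P L X \<subseteq> S"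
  by (auto simp: pls_span_def)

lemma pls_span_mono: "X \<subseteq> Y \<Longrightarrow> pls_span P L X \<subseteq> pls_span P L Y"
  by (auto simp: pls_span_def)

lemma pls_span_subspace_eq: "pls_subspace P L S \<Longrightarrow> pls_span P L S = S"
  by (simp add: pls_span_least pls_span_superset subset_antisym)

lemma graph_dist_le_iff: "graph_dist E x y \<le> enat m \<longleftrightarrow> (\<exists>k\<le>m. (x, y) \<in> E ^^ k)"
proof
  assume le: "graph_dist E x y \<le> enat m"
  show "\<exists>k\<le>m. (x, y) \<in> E ^^ k"
  proof (rule ccontr)
    assume "\<not> ?thesis"
    \<comment> \<open>Every walk has more than \<open>m\<close> edges, so the infimum, infinite if
      there is no walk, is at least \<open>m + 1\<close>.\<close>
    then have "enat (Suc m) \<le> graph_dist E x y"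
      unfolding graph_dist_def by (intro INF_greatest) (auto simp: not_le Suc_le_eq)
    then have "enat (Suc m) \<le> enat m" using le by (rule order_trans)
    then show False by simp
  qed
next
  assume "\<exists>k\<le>m. (x, y) \<in> E ^^ k"
  then obtain k where k: "k \<le> m" "(x, y) \<in> E ^^ k" by blast
  then show "graph_dist E x y \<le> enat m"
    unfolding graph_dist_def by (intro INF_lower2[of k]) auto
qed

lemma walk_le_1: "(\<exists>k\<le>1. (x, y) \<in> E ^^ k) \<longleftrightarrow> x = y \<or> (x, y) \<in> E"
proof -
  have "(\<exists>k\<le>1. Q k) \<longleftrightarrow> Q 0 \<or> Q 1" for Q :: "nat \<Rightarrow> bool"
    by (metis le_zero_eq le_Suc_eq One_nat_def order_refl zero_le)
  from this[of "\<lambda>k. (x, y) \<in> E ^^ k"] show ?thesis by simp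
qed

subsection \<open>Perps and the exchange property\<close>

text \<open>Axioms common to polar spaces and thin polar spaces. Finiteness of the rank enters
  through \<open>maximal_dim\<close>, which later bounds the size of independent sets.\<close>

locale polar_geometry =
  fixes P :: "'a set" and L :: "'a set set" and n :: nat
  assumes pls: "partial_linear_space P L"
    and rank_ge_2: "2 \<le> n"
    and nondegenerate: "p \<in> P \<Longrightarrow> \<exists>q\<in>P. \<not> pls_collinear L p q"
    and one_or_all: "p \<in> P \<Longrightarrow> l \<in> L \<Longrightarrow>
      (\<exists>!q. q \<in> l \<and> pls_collinear L p q) \<or> (\<forall>q\<in>l. pls_collinear L p q)"
    and maximal_dim: "maximal_singular_subspace P L M \<Longrightarrow> singular_subspace_of_dim P L (n - 1) M"
begin

abbreviation col :: "'a \<Rightarrow> 'a \<Rightarrow> bool" where "col \<equiv> pls_collinear L"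
abbreviation span :: "'a set \<Rightarrow> 'a set" where "span \<equiv> pls_span P L"
abbreviation subsp :: "'a set \<Rightarrow> bool" where "subsp \<equiv> pls_subspace P L"
abbreviation sing :: "'a set \<Rightarrow> bool" where "sing \<equiv> singular_subspace P L"
abbreviation maxsing :: "'a set \<Rightarrow> bool" where "maxsing \<equiv> maximal_singular_subspace P L"

definition perp :: "'a set \<Rightarrow> 'a set" where
  "perp X = {y \<in> P. \<forall>x\<in>X. col x y}"

text \<open>This form fits the Galois connection \<open>perp_galois\<close>;
  \<open>clique_iff\<close> translates it into pairwise collinearity.\<close>

definition clique :: "'a set \<Rightarrow> bool" where
  "clique X \<longleftrightarrow> X \<subseteq> perp X"

lemma line_in_P: "l \<in> L \<Longrightarrow> x \<in> l \<Longrightarrow> x \<in> P"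
  using pls unfolding partial_linear_space_def by blast

lemma col_refl: "p \<in> P \<Longrightarrow> col p p"
  using pls unfolding partial_linear_space_def pls_collinear_def by blast

lemma col_sym: "col p q \<Longrightarrow> col q p"
  unfolding pls_collinear_def by blast

lemma col_all_of_two:
  "\<lbrakk>p \<in> P; l \<in> L; x \<in> l; y \<in> l; x \<noteq> y; col p x; col p y; z \<in> l\<rbrakk> \<Longrightarrow> col p z"
  using one_or_all[of p l] by blast

lemma obtain_meet:
  assumes "p \<in> P" "col x y"
  obtains l z where "l \<in> L" "x \<in> l" "y \<in> l" "z \<in> l" "col p z"
  using assms one_or_all[of p] unfolding pls_collinear_def by metis

lemma col_of_line: "l \<in> L \<Longrightarrow> x \<in> l \<Longrightarrow> y \<in> l \<Longrightarrow> col x y"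
  unfolding pls_collinear_def by blast

lemma subsp_line:
  "subsp S \<Longrightarrow> p \<in> S \<Longrightarrow> q \<in> S \<Longrightarrow> p \<noteq> q \<Longrightarrow> l \<in> L \<Longrightarrow> p \<in> l \<Longrightarrow> q \<in> l \<Longrightarrow> l \<subseteq> S"
  unfolding pls_subspace_def by simp

lemma subsp_P: "subsp P"
  using pls unfolding partial_linear_space_def pls_subspace_def by blast

lemma subsp_span: "X \<subseteq> P \<Longrightarrow> subsp (span X)"
  using pls_span_least[OF subsp_P]
  unfolding pls_subspace_def pls_span_def by blast

lemma span_base: "x \<in> X \<Longrightarrow> x \<in> span X"
  using pls_span_superset by (rule subsetD)

lemma subsp_empty: "subsp {}"
  by (simp add: pls_subspace_def)

lemma subsp_singleton: "x \<in> P \<Longrightarrow> subsp {x}"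
  by (simp add: pls_subspace_def)

lemma subsp_Int:
  assumes "subsp S" "subsp T"
  shows "subsp (S \<inter> T)"
  unfolding pls_subspace_def
proof (intro conjI ballI impI)
  show "S \<inter> T \<subseteq> P" using assms(1) by (auto simp: pls_subspace_def)
next
  fix p q l assume "p \<in> S \<inter> T" "q \<in> S \<inter> T" "p \<noteq> q" "l \<in> L" "p \<in> l \<and> q \<in> l"
  then show "l \<subseteq> S \<inter> T" using subsp_line[OF assms(1), of p q l] subsp_line[OF assms(2), of p q l] by simp
qed

lemma perp_P: "perp X \<subseteq> P" by (auto simp: perp_def)

lemma subsp_perp: "X \<subseteq> P \<Longrightarrow> subsp (perp X)"
  unfolding pls_subspace_def perp_def using col_all_of_two line_in_P by blast

lemma perp_anti: "X \<subseteq> Y \<Longrightarrow> perp Y \<subseteq> perp X"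
  by (auto simp: perp_def)

lemma perp_galois: "X \<subseteq> P \<Longrightarrow> Y \<subseteq> P \<Longrightarrow> X \<subseteq> perp Y \<longleftrightarrow> Y \<subseteq> perp X"
  unfolding perp_def using col_sym by blast

text \<open>The double perp of \<open>X\<close> is a subspace containing \<open>X\<close>, so it
  contains the span of \<open>X\<close>.\<close>

lemma perp_span: assumes "X \<subseteq> P" shows "perp (span X) = perp X"
proof
  show "perp (span X) \<subseteq> perp X" by (rule perp_anti[OF pls_span_superset])
  have XP: "perp X \<subseteq> P" by (rule perp_P)
  have "X \<subseteq> perp (perp X)" using perp_galois[OF assms XP] by blast
  then have "span X \<subseteq> perp (perp X)" by (rule pls_span_least[OF subsp_perp[OF XP]])
  then show "perp X \<subseteq> perp (span X)"
    using perp_galois[OF pls_span_least[OF subsp_P assms] XP] by simp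
qed

lemma subsp_subset_P: "subsp S \<Longrightarrow> S \<subseteq> P"
  unfolding pls_subspace_def by simp

lemma clique_iff: "clique X \<longleftrightarrow> X \<subseteq> P \<and> (\<forall>x\<in>X. \<forall>y\<in>X. x \<noteq> y \<longrightarrow> col x y)"
  unfolding clique_def perp_def subset_iff mem_Collect_eq using col_refl by metis

lemma sing_iff: "sing S \<longleftrightarrow> subsp S \<and> clique S"
  unfolding singular_subspace_def clique_iff using subsp_subset_P by auto

lemma clique_P: "clique X \<Longrightarrow> X \<subseteq> P"
  unfolding clique_def using perp_P by blast

lemma clique_span:
  assumes "clique X"
  shows "sing (span X)"
proof -
  have X: "X \<subseteq> P" using assms by (rule clique_P)
  have "span X \<subseteq> perp X"
    using assms pls_span_least[OF subsp_perp[OF X]] by (simp add: clique_def)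
  then show ?thesis using perp_span[OF X] subsp_span[OF X] by (simp add: sing_iff clique_def)
qed

lemma clique_subset: "clique Y \<Longrightarrow> X \<subseteq> Y \<Longrightarrow> clique X"
  unfolding clique_def perp_def by blast

lemma clique_insert: "clique (insert x X) \<longleftrightarrow> clique X \<and> x \<in> perp X"
  unfolding clique_def perp_def using col_refl col_sym by blast

lemma clique_empty: "clique {}" by (simp add: clique_def)

lemma sing_P: "sing S \<Longrightarrow> S \<subseteq> P" by (simp add: sing_iff clique_P)

lemma sing_span_eq: "sing S \<Longrightarrow> span S = S" by (simp add: sing_iff pls_span_subspace_eq)

lemma sing_col: "sing S \<Longrightarrow> x \<in> S \<Longrightarrow> y \<in> S \<Longrightarrow> col x y"
  unfolding sing_iff clique_def perp_def by blast

lemma sing_Int: "sing S \<Longrightarrow> subsp T \<Longrightarrow> sing (S \<inter> T)"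
  by (meson Int_lower1 clique_subset sing_iff subsp_Int)

lemma perp_insert: "perp (insert x X) = {y \<in> perp X. col x y}"
  by (auto simp: perp_def)

lemma perp_line:
  assumes "X \<subseteq> P" "l \<in> L" "x \<in> l" "y \<in> l" "x \<noteq> y" "x \<in> perp X" "y \<in> perp X" "z \<in> l"
  shows "z \<in> perp X"
  using subsp_line[OF subsp_perp[OF assms(1)], of x y l] assms by blast

text \<open>Nondegeneracy settles empty \<open>X\<close>. When a generator \<open>b\<close> is
  added, the witnesses from the induction hypothesis may fail to be collinear with \<open>b\<close>;
  they are corrected by moving along lines inside \<open>perp X\<close>.\<close>

lemma not_in_double_perp:
  "finite X \<Longrightarrow> clique X \<Longrightarrow> k \<in> P \<Longrightarrow> k \<notin> span X \<Longrightarrow> \<exists>w\<in>perp X. \<not> col w k"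
proof (induction X arbitrary: k rule: finite_induct)
  case empty
  then show ?case using nondegenerate[of k] col_sym[of _ k] by (auto simp: perp_def)
next
  case (insert b X)
  have cX: "clique X" and bX: "b \<in> perp X" using insert.prems clique_insert by auto
  have XP: "X \<subseteq> P" using cX clique_P by blast
  have bP: "b \<in> P" using bX perp_P by blast
  show ?case
  proof (cases "k \<in> perp (insert b X)")
    case False
    \<comment> \<open>A clique lies in its own perp, so a member that is not collinear with
      \<open>k\<close> is already a witness.\<close>
    then obtain w where "w \<in> insert b X" "\<not> col w k" using insert.prems(2) by (auto simp: perp_def)
    then show ?thesis using insert.prems(1) unfolding clique_def by blast
  next
    case True
    then have kX: "k \<in> perp X" and bk: "col b k" by (auto simp: perp_insert)
    have sub: "subsp (span (insert b X))" using subsp_span XP bP by blast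
    have bs: "b \<in> span (insert b X)" by (simp add: span_base)
    have sX: "span X \<subseteq> span (insert b X)" by (rule pls_span_mono) blast
    have kb: "k \<noteq> b" using bs insert.prems by blast
    have "k \<notin> span X" using sX insert.prems by blast
    then obtain w0 where w0: "w0 \<in> perp X" "\<not> col w0 k" using insert.IH cX insert.prems(2) by blast
    have w0P: "w0 \<in> P" using w0 perp_P by blast
    show ?thesis
    proof (cases "col w0 b")
      case True
      then show ?thesis using w0 col_sym by (auto simp: perp_insert)
    next
      case w0b: False
      \<comment> \<open>\<open>c\<close> is a point of a line through \<open>b\<close> and
        \<open>k\<close> collinear with \<open>w0\<close>. From here on a witness may be collinear
        with \<open>b\<close> but not with \<open>c\<close>: collinearity with both \<open>b\<close>
        and \<open>k\<close> would spread to the whole line.\<close>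
      obtain l c where l: "l \<in> L" "b \<in> l" "k \<in> l" "c \<in> l" and c: "col w0 c"
        using obtain_meet[OF w0P bk] by metis
      have cb: "c \<noteq> b" and ck: "c \<noteq> k" using c w0 w0b by auto
      have cP: "c \<in> P" using l line_in_P by blast
      have cX': "c \<in> perp X" using perp_line[OF XP l(1,2,3)] bX kX kb l(4) by blast
      have "c \<notin> span X"
      proof
        assume "c \<in> span X"
        then have "l \<subseteq> span (insert b X)"
          using subsp_line[OF sub bs, of c l] sX cb l by blast
        then show False using l insert.prems by blast
      qed
      then obtain w1 where w1: "w1 \<in> perp X" "\<not> col w1 c" using insert.IH cX cP by blast
      have w1P: "w1 \<in> P" using w1 perp_P by blast
      have witness: ?thesis if w: "w \<in> perp X" "col w b" "\<not> col w c" for w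
      proof -
        have "\<not> col w k" using col_all_of_two[OF _ l(1,2,3)] kb w l perp_P by blast
        then show ?thesis using w col_sym by (auto simp: perp_insert)
      qed
      show ?thesis
      proof (cases "col w1 b")
        case True then show ?thesis using w1 witness by blast
      next
        case w1b: False
        \<comment> \<open>\<open>w1\<close> is corrected in two turns. First \<open>w2\<close>, on a
          line through \<open>c\<close> and \<open>w0\<close>, is collinear with \<open>w1\<close>
          and \<open>c\<close> but not with \<open>b\<close>. Then \<open>w3\<close>, on a line
          through \<open>w1\<close> and \<open>w2\<close>, is collinear with \<open>b\<close>; were
          it also collinear with \<open>c\<close>, then \<open>c\<close> would be collinear with
          \<open>w2\<close> and \<open>w3\<close>, hence with \<open>w1\<close>.\<close>
        obtain m w2 where m: "m \<in> L" "c \<in> m" "w0 \<in> m" "w2 \<in> m" and w12: "col w1 w2"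
          using obtain_meet[OF w1P, of c w0] c col_sym by metis
        have w2c: "w2 \<noteq> c" using w12 w1 by auto
        have cw0: "c \<noteq> w0" using bk w0b l col_of_line by blast
        have w2X: "w2 \<in> perp X" using perp_line[OF XP m(1,2,3)] cw0 cX' w0 m by blast
        have w2b: "\<not> col b w2"
          using col_all_of_two[OF bP m(1) m(2) m(4) _ _ _ m(3)] w2c col_of_line[OF l(1) l(2) l(4)] w0b col_sym by blast
        obtain r w3 where r: "r \<in> L" "w1 \<in> r" "w2 \<in> r" "w3 \<in> r" and w3: "col b w3"
          using obtain_meet[OF bP w12] by metis
        have w1w2: "w1 \<noteq> w2" using m w1 col_of_line by blast
        have w3X: "w3 \<in> perp X" using perp_line[OF XP r(1,2,3)] w1w2 w1 w2X r by blast
        have "w3 \<noteq> w2" using w3 w2b by blast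
        have "\<not> col w3 c"
          using col_all_of_two[OF cP r(1) r(4) r(3) \<open>w3 \<noteq> w2\<close> _ _ r(2)]
            col_of_line[OF m(1) m(2) m(4)] w1 col_sym by blast
        then show ?thesis using witness w3X w3 col_sym by blast
      qed
    qed
  qed
qed

text \<open>If exchange failed, \<open>not_in_double_perp\<close> would give \<open>w\<close> in
  \<open>perp X\<close> collinear with \<open>y\<close> but not with \<open>x\<close>, and
  \<open>v\<close> in \<open>perp X\<close> not collinear with \<open>y\<close>. Replacing
  \<open>v\<close> by a point \<open>v2\<close> that is moreover collinear with \<open>w\<close>
  leads to a contradiction on the line through \<open>w\<close> and \<open>v2\<close>.\<close>

lemma exchange:
  assumes fin: "finite X" and cl: "clique (insert x X)" and y: "y \<in> span (insert x X)" "y \<notin> span X"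
  shows "x \<in> span (insert y X)"
proof (rule ccontr)
  assume nx: "x \<notin> span (insert y X)"
  have cX: "clique X" and xX: "x \<in> perp X" using cl clique_insert by auto
  have XP: "insert x X \<subseteq> P" using cl clique_P by blast
  have s: "sing (span (insert x X))" using cl clique_span by blast
  have xs: "x \<in> span (insert x X)" "X \<subseteq> span (insert x X)" by (auto intro: span_base)
  have yP: "y \<in> P" using s y sing_P by blast
  have xP: "x \<in> P" using XP by blast
  have xy: "col x y" using sing_col[OF s xs(1) y(1)] .
  have yX: "y \<in> perp X" using sing_col[OF s _ y(1)] xs yP by (auto simp: perp_def)
  have p: "perp (insert x X) \<subseteq> perp {y}"
    using perp_span[OF XP] perp_anti[of "{y}" "span (insert x X)"] y(1) by blast
  have *: "col y z" if "z \<in> perp X" "col x z" for z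
    using p that by (auto simp: perp_def)
  obtain w where "w \<in> perp (insert y X)" and wx: "\<not> col w x"
    using not_in_double_perp[of "insert y X" x] fin clique_insert cX yX nx xP by blast
  then have wX: "w \<in> perp X" and wy: "col y w" by (auto simp: perp_insert)
  have wP: "w \<in> P" using wX perp_P by blast
  obtain v where vX: "v \<in> perp X" and vy: "\<not> col v y"
    using not_in_double_perp[OF fin cX yP y(2)] by blast
  have vP: "v \<in> P" using vX perp_P by blast
  \<comment> \<open>A point \<open>u\<close> of the line through \<open>w\<close> and
    \<open>v2\<close> that is collinear with \<open>x\<close> is also collinear with
    \<open>y\<close>, because \<open>y\<close> lies in the span of \<open>insert x X\<close>. Then
    \<open>y\<close> is collinear with \<open>u\<close> and \<open>w\<close>, hence with
    \<open>v2\<close>.\<close>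
  have key: False if v2: "v2 \<in> perp X" "\<not> col v2 y" "col w v2" for v2
  proof -
    have wv: "w \<noteq> v2" using v2 wy col_sym by blast
    obtain l u where l: "l \<in> L" "w \<in> l" "v2 \<in> l" "u \<in> l" and u: "col x u"
      using obtain_meet[OF xP v2(3)] by metis
    have "u \<in> perp X" using perp_line[of X l w v2 u] XP l wv wX v2 by blast
    then have "col y u" using * u by blast
    moreover have "u \<noteq> w" using u wx col_sym by blast
    ultimately have "col y v2" using col_all_of_two[OF yP l(1,4,2)] wy l(3) by blast
    then show False using v2 col_sym by blast
  qed
  have vx: "\<not> col x v" using * vX vy col_sym by blast
  obtain l z where l: "l \<in> L" "x \<in> l" "y \<in> l" "z \<in> l" and z: "col v z"
    using obtain_meet[OF vP xy] by metis
  have xny: "x \<noteq> y" using wx wy col_sym by blast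
  have zX: "z \<in> perp X" using perp_line[of X l x y z] XP l xny xX yX by blast
  \<comment> \<open>\<open>v2\<close> lies on a line joining \<open>v\<close> to a point
    \<open>z\<close> of the line through \<open>x\<close> and \<open>y\<close>. As \<open>y\<close>
    is collinear with \<open>z\<close>, it cannot be collinear with \<open>v2\<close> without being
    collinear with \<open>v\<close>.\<close>
  obtain m v2 where m: "m \<in> L" "v \<in> m" "z \<in> m" "v2 \<in> m" and v2: "col w v2"
    using obtain_meet[OF wP z] by metis
  have zx: "z \<noteq> x" "z \<noteq> y" using z vx vy col_sym by blast+
  have "\<not> col w z"
    using col_all_of_two[OF wP l(1) l(4) l(3) zx(2) _ _ l(2)] wy wx col_sym by blast
  then have "v2 \<noteq> z" using v2 by blast
  have "v \<noteq> z" using l vx col_of_line by blast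
  have "v2 \<in> perp X" using perp_line[of X m v z v2] XP m \<open>v \<noteq> z\<close> vX zX by blast
  moreover have "\<not> col v2 y"
    using col_all_of_two[OF yP m(1) m(4) m(3) \<open>v2 \<noteq> z\<close> _ _ m(2)] vy col_sym col_of_line[OF l(1) l(3) l(4)] by blast
  ultimately show False using key v2 by blast
qed

subsection \<open>Rank of singular subspaces\<close>

text \<open>Restricted to finite cliques, where \<open>exchange\<close> is available;
  \<open>independent_iff_indep\<close> relates it to \<open>pls_independent\<close>.\<close>

definition indep :: "'a set \<Rightarrow> bool" where
  "indep X \<longleftrightarrow> finite X \<and> clique X \<and> (\<forall>x\<in>X. x \<notin> span (X - {x}))"

lemma span_insert_span:
  assumes "clique (insert x X)"
  shows "span (insert x (span X)) = span (insert x X)"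
proof
  have "subsp (span (insert x X))" by (rule subsp_span[OF clique_P[OF assms]])
  moreover have "span X \<subseteq> span (insert x X)" by (rule pls_span_mono) blast
  ultimately show "span (insert x (span X)) \<subseteq> span (insert x X)"
    by (simp add: pls_span_least span_base)
  show "span (insert x X) \<subseteq> span (insert x (span X))"
    by (rule pls_span_mono) (auto intro: span_base)
qed

lemma span_subset_sing: "sing S \<Longrightarrow> X \<subseteq> S \<Longrightarrow> span X \<subseteq> S"
  by (simp add: sing_iff pls_span_least)

lemma indep_subset: "indep X \<Longrightarrow> Y \<subseteq> X \<Longrightarrow> indep Y"
  unfolding indep_def
  by (meson Diff_mono clique_subset finite_subset pls_span_mono subset_iff subset_refl)

text \<open>If adding \<open>x\<close> made some \<open>y\<close> in \<open>X\<close> dependent on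
  the others, exchange would put \<open>x\<close> into the span of \<open>X\<close>.\<close>

lemma indep_insert:
  assumes "indep X" "x \<in> perp X" "x \<notin> span X"
  shows "indep (insert x X)"
proof -
  have xX: "x \<notin> X" using assms(3) span_base by blast
  have cl: "clique (insert x X)" using assms by (simp add: indep_def clique_insert)
  have "y \<notin> span (insert x X - {y})" if y: "y \<in> X" for y
  proof
    assume "y \<in> span (insert x X - {y})"
    moreover have "insert x X - {y} = insert x (X - {y})" using y xX by blast
    moreover have "y \<notin> span (X - {y})" "finite (X - {y})" using assms(1) y by (auto simp: indep_def)
    moreover have "clique (insert x (X - {y}))" by (rule clique_subset[OF cl]) blast
    ultimately have "x \<in> span (insert y (X - {y}))" using exchange[of "X - {y}" x y] by simp
    then show False using assms(3) y by (simp add: insert_absorb)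
  qed
  then show ?thesis using assms cl xX by (simp add: indep_def)
qed

text \<open>An element \<open>i\<close> of \<open>I\<close> outside \<open>G\<close> is traded for
  some \<open>g\<close> in \<open>G\<close> outside the span of the rest of \<open>I\<close>. Such a
  \<open>g\<close> exists, since otherwise the rest of \<open>I\<close> would span all of
  \<open>span G\<close>, including \<open>i\<close>.\<close>

lemma steinitz:
  assumes "finite G" "clique G"
  shows "indep I \<Longrightarrow> I \<subseteq> span G \<Longrightarrow> card I \<le> card G"
proof (induction "card (I - G)" arbitrary: I rule: less_induct)
  case less
  have fI: "finite I" using less.prems by (simp add: indep_def)
  have sG: "sing (span G)" using assms clique_span by blast
  show ?case
  proof (cases "I \<subseteq> G")
    case True
    then show ?thesis using assms by (simp add: card_mono)
  next
    case False
    then obtain i where i: "i \<in> I" "i \<notin> G" by blast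
    let ?J = "I - {i}"
    have J: "indep ?J" using less.prems(1) indep_subset by blast
    have "\<exists>g\<in>G. g \<notin> span ?J"
    proof (rule ccontr)
      assume "\<not> ?thesis"
      then have "G \<subseteq> span ?J" by blast
      moreover have "subsp (span ?J)" using J clique_P subsp_span[of ?J] by (simp add: indep_def)
      ultimately have "span G \<subseteq> span ?J" by (simp add: pls_span_least)
      then show False using less.prems i by (auto simp: indep_def)
    qed
    then obtain g where g: "g \<in> G" "g \<notin> span ?J" by blast
    have gG: "g \<in> span G" using g span_base by blast
    have "g \<in> perp ?J"
      using sing_col[OF sG] gG less.prems(2) sing_P[OF sG] by (auto simp: perp_def)
    then have "indep (insert g ?J)" using J g indep_insert by blast
    moreover have "insert g ?J \<subseteq> span G" using gG less.prems by blast
    moreover have "card (insert g ?J - G) < card (I - G)"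
      using g i fI by (intro psubset_card_mono) auto
    ultimately have "card (insert g ?J) \<le> card G" using less.hyps by blast
    moreover have "g \<notin> ?J" using g span_base[of g ?J] by auto
    ultimately show ?thesis using fI i by (simp add: card_Suc_Diff1)
  qed
qed

section \<open>Maximal singular subspaces, bases and the rank function\<close>

lemma sing_Union_chain:
  assumes "C \<noteq> {}" "subset.chain {T. sing T} C"
  shows "sing (\<Union>C)"
proof -
  have C: "sing T" if "T \<in> C" for T using assms that by (auto simp: subset.chain_def)
  have two: "\<exists>T\<in>C. x \<in> T \<and> y \<in> T" if "x \<in> \<Union>C" "y \<in> \<Union>C" for x y
    using assms that unfolding subset_chain_def by blast
  have "\<Union>C \<subseteq> P" using C sing_P by blast
  moreover have "l \<subseteq> \<Union>C"
    if xy: "x \<in> \<Union>C" "y \<in> \<Union>C" "x \<noteq> y" "l \<in> L" "x \<in> l \<and> y \<in> l" for x y l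
  proof -
    obtain T where T: "T \<in> C" "x \<in> T" "y \<in> T" using two[OF xy(1,2)] by blast
    then have "l \<subseteq> T" using subsp_line[of T x y l] C xy by (simp add: sing_iff)
    then show ?thesis using T by blast
  qed
  moreover have "col x y" if xy: "x \<in> \<Union>C" "y \<in> \<Union>C" for x y
    using two[OF xy] C sing_col by blast
  ultimately show ?thesis unfolding singular_subspace_def pls_subspace_def by simp
qed

lemma maximal_exists:
  assumes "sing S"
  obtains M where "maxsing M" "S \<subseteq> M"
proof -
  let ?A = "{T. sing T \<and> S \<subseteq> T}"
  have "\<exists>M\<in>?A. \<forall>X\<in>?A. M \<subseteq> X \<longrightarrow> X = M"
  proof (rule subset_Zorn_nonempty)
    show "?A \<noteq> {}" using assms by blast
    fix C assume C: "C \<noteq> {}" "subset.chain ?A C"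
    then have "subset.chain {T. sing T} C" by (auto simp: subset_chain_def)
    then have "sing (\<Union>C)" by (rule sing_Union_chain[OF C(1)])
    moreover obtain T where "T \<in> C" using C(1) by blast
    moreover have "S \<subseteq> T" using \<open>T \<in> C\<close> C(2) by (auto simp: subset_chain_def)
    ultimately show "\<Union>C \<in> ?A" by blast
  qed
  then obtain M where "sing M" "S \<subseteq> M" and max: "\<forall>X\<in>?A. M \<subseteq> X \<longrightarrow> X = M" by blast
  moreover have "X = M" if "sing X" "M \<subseteq> X" for X
    using max that order_trans[OF \<open>S \<subseteq> M\<close> that(2)] by simp
  ultimately show thesis by (intro that[of M]) (simp_all add: maximal_singular_subspace_def)
qed

lemma maxsing_sing: "maxsing M \<Longrightarrow> sing M"
  by (simp add: maximal_singular_subspace_def)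

text \<open>A maximal singular subspace containing \<open>X\<close> is spanned by \<open>n\<close>
  points, so the Steinitz bound applies.\<close>

lemma indep_card_le:
  assumes "indep X" shows "card X \<le> n"
proof -
  have "sing (span X)" using assms clique_span by (simp add: indep_def)
  then obtain M where M: "maxsing M" "span X \<subseteq> M" by (rule maximal_exists)
  then obtain G where G: "finite G" "card G = n - 1 + 1" "span G = M"
    using maximal_dim unfolding singular_subspace_of_dim_def by blast
  have "G \<subseteq> M" using G by (auto intro: span_base)
  then have "clique G" using clique_subset[of M G] maxsing_sing[OF M(1)] by (simp add: sing_iff)
  then have "card X \<le> card G" using steinitz[of G X] G M assms pls_span_superset[of X P L] by blast
  then show ?thesis using G rank_ge_2 by simp
qed

text \<open>As independent sets have at most \<open>n\<close> points, there is a largest one between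
  \<open>J\<close> and \<open>S\<close>; a point of \<open>S\<close> outside its span would enlarge
  it.\<close>

lemma base_extend:
  assumes "sing S" "indep J" "J \<subseteq> S"
  obtains B where "indep B" "J \<subseteq> B" "B \<subseteq> S" "span B = S"
proof -
  let ?Q = "\<lambda>B. indep B \<and> J \<subseteq> B \<and> B \<subseteq> S"
  have "?Q J" using assms by blast
  moreover have "\<forall>B. ?Q B \<longrightarrow> card B < Suc n" using indep_card_le by (simp add: less_Suc_eq_le)
  ultimately obtain B where B: "?Q B" "\<forall>C. ?Q C \<longrightarrow> card C \<le> card B"
    using ex_has_greatest_nat[of ?Q J card "Suc n"] by blast
  have "S \<subseteq> span B"
  proof
    fix x assume x: "x \<in> S"
    show "x \<in> span B"
    proof (rule ccontr)
      assume nx: "x \<notin> span B"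
      have "x \<in> perp B" using sing_col[OF assms(1)] x B(1) sing_P[OF assms(1)] by (auto simp: perp_def)
      then have "?Q (insert x B)" using B x nx indep_insert by blast
      then have "card (insert x B) \<le> card B" using B by blast
      moreover have "x \<notin> B" "finite B" using nx span_base[of x B] B by (auto simp: indep_def)
      ultimately show False by simp
    qed
  qed
  moreover have "span B \<subseteq> S" using span_subset_sing assms B by blast
  ultimately show thesis using that B by blast
qed

lemma indep_empty: "indep {}" by (simp add: indep_def clique_empty)

text \<open>The projective dimension plus one; \<open>rk_span\<close> shows that the choice of the
  base does not matter.\<close>

definition rk :: "'a set \<Rightarrow> nat" where
  "rk S = card (SOME B. indep B \<and> span B = S)"

lemma rk_span:
  assumes "indep B" shows "rk (span B) = card B"
proof -
  define C where "C = (SOME C. indep C \<and> span C = span B)"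
  have C: "indep C \<and> span C = span B" unfolding C_def by (rule someI[of _ B]) (simp add: assms)
  have "card B \<le> card C" using steinitz[of C B] C assms pls_span_superset[of B P L] by (simp add: indep_def)
  moreover have "card C \<le> card B" using steinitz[of B C] C assms pls_span_superset[of C P L] by (simp add: indep_def)
  ultimately show ?thesis unfolding rk_def C_def[symmetric] by simp
qed

lemma obtain_base:
  assumes "sing S"
  obtains B where "indep B" "span B = S" "card B = rk S"
  using base_extend[OF assms indep_empty] rk_span by (metis empty_subsetI)

lemma rk_less:
  assumes "sing S" "sing T" "S \<subset> T"
  shows "rk S < rk T"
proof -
  obtain B where B: "indep B" "span B = S" "card B = rk S" using obtain_base assms by blast
  have "B \<subseteq> T" using B pls_span_superset[of B P L] assms by blast
  then obtain C where C: "indep C" "B \<subseteq> C" "span C = T" using base_extend assms B by metis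
  have "B \<noteq> C" using B C assms by blast
  then have "card B < card C" using C by (intro psubset_card_mono) (auto simp: indep_def)
  then show ?thesis using B C rk_span by metis
qed

lemma rk_mono: "sing S \<Longrightarrow> sing T \<Longrightarrow> S \<subseteq> T \<Longrightarrow> rk S \<le> rk T"
  using rk_less by (cases "S = T") (auto simp: less_imp_le psubset_eq)

lemma eq_if_rk_le: "sing S \<Longrightarrow> sing T \<Longrightarrow> S \<subseteq> T \<Longrightarrow> rk T \<le> rk S \<Longrightarrow> S = T"
  using rk_less[of S T] by (auto simp: psubset_eq)

lemma sing_span_insert: "sing S \<Longrightarrow> x \<in> perp S \<Longrightarrow> sing (span (insert x S))"
  by (rule clique_span) (simp add: clique_insert sing_iff)

lemma rk_insert:
  assumes "sing S" "x \<in> perp S" "x \<notin> S"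
  shows "rk (span (insert x S)) = Suc (rk S)"
proof -
  obtain B where B: "indep B" "span B = S" "card B = rk S" using obtain_base assms by blast
  have cB: "clique B" using B by (simp add: indep_def)
  have "B \<subseteq> S" using B pls_span_superset[of B P L] by blast
  then have xB: "x \<in> perp B" using assms(2) perp_anti[of B S] by blast
  have "indep (insert x B)" using indep_insert[of B x] B assms xB by simp
  moreover have "span (insert x B) = span (insert x S)"
    using span_insert_span[of x B] cB xB clique_insert B by simp
  moreover have "x \<notin> B" "finite B" using \<open>B \<subseteq> S\<close> assms B by (auto simp: indep_def)
  ultimately show ?thesis using rk_span[of "insert x B"] B by simp
qed

lemma sing_empty: "sing {}" by (simp add: sing_iff subsp_empty clique_empty)

lemma rk_empty: "rk {} = 0"
  using rk_span[OF indep_empty] sing_span_eq[OF sing_empty] by simp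

lemma sing_singleton: "x \<in> P \<Longrightarrow> sing {x}"
  by (simp add: sing_iff subsp_singleton clique_insert clique_empty perp_def)

lemma indep_singleton: assumes "x \<in> P" shows "indep {x}"
  using indep_insert[OF indep_empty, of x] sing_span_eq[OF sing_empty] assms by (simp add: perp_def)

lemma rk_singleton: assumes "x \<in> P" shows "rk {x} = 1"
  using rk_insert[of "{}" x] sing_span_eq[OF sing_singleton[OF assms]] assms
  by (simp add: sing_empty perp_def rk_empty)

text \<open>Every proper subset of \<open>B\<close> lies in some \<open>B - {x}\<close>, so testing
  the removal of single points is enough.\<close>

lemma independent_iff_indep:
  assumes "finite B" "sing (span B)"
  shows "pls_independent P L B \<longleftrightarrow> indep B"
proof
  have "B \<subseteq> span B" by (auto intro: span_base)
  then have cB: "clique B" using assms(2) clique_subset[of "span B" B] by (simp add: sing_iff)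
  assume ind: "pls_independent P L B"
  have "x \<notin> span (B - {x})" if x: "x \<in> B" for x
  proof
    assume "x \<in> span (B - {x})"
    then have "B \<subseteq> span (B - {x})" by (auto intro: span_base)
    moreover have "subsp (span (B - {x}))" using clique_P[OF cB] subsp_span[of "B - {x}"] by blast
    ultimately have "span B = span (B - {x})"
      by (simp add: pls_span_least pls_span_mono subset_antisym)
    moreover have "B - {x} \<subset> B" using x by blast
    ultimately show False using ind unfolding pls_independent_def by metis
  qed
  then show "indep B" using assms cB by (simp add: indep_def)
next
  assume i: "indep B"
  have "span Y \<noteq> span B" if Y: "Y \<subset> B" for Y
  proof
    assume e: "span Y = span B"
    obtain x where x: "x \<in> B" "x \<notin> Y" using Y by blast
    then have "span Y \<subseteq> span (B - {x})" using Y by (intro pls_span_mono) blast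
    then show False using e i x span_base[of x B] by (auto simp: indep_def)
  qed
  then show "pls_independent P L B" using i clique_P by (auto simp: indep_def pls_independent_def)
qed

lemma dim_iff_rk: "singular_subspace_of_dim P L k S \<longleftrightarrow> sing S \<and> rk S = k + 1"
proof
  assume "singular_subspace_of_dim P L k S"
  then obtain B where "sing S" "finite B" "card B = k + 1" "pls_independent P L B" "span B = S"
    unfolding singular_subspace_of_dim_def by blast
  then show "sing S \<and> rk S = k + 1" using independent_iff_indep rk_span by metis
next
  assume S: "sing S \<and> rk S = k + 1"
  then obtain B where "indep B" "span B = S" "card B = rk S" using obtain_base by blast
  then show "singular_subspace_of_dim P L k S"
    using S independent_iff_indep unfolding singular_subspace_of_dim_def
    by (metis indep_def)
qed

lemma rk_le: assumes "sing S" shows "rk S \<le> n"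
  using obtain_base[OF assms] indep_card_le by metis

lemma maxsing_iff_rk: "maxsing M \<longleftrightarrow> sing M \<and> rk M = n"
proof
  assume "maxsing M"
  then show "sing M \<and> rk M = n" using maximal_dim dim_iff_rk rank_ge_2 by fastforce
next
  assume "sing M \<and> rk M = n"
  then show "maxsing M"
    unfolding maximal_singular_subspace_def using eq_if_rk_le rk_le by metis
qed

section \<open>Submaximal subspaces as sections of maximal ones by perps\<close>

definition submax :: "'a set \<Rightarrow> bool" where
  "submax S \<longleftrightarrow> sing S \<and> rk S = n - 1"

lemma grassmannian_max: "polar_grassmannian P L (n - 1) = {M. maxsing M}"
  using rank_ge_2 by (simp add: polar_grassmannian_def dim_iff_rk maxsing_iff_rk)

lemma grassmannian_submax: "polar_grassmannian P L (n - 2) = {S. submax S}"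
proof -
  have "n - 2 + 1 = n - 1" using rank_ge_2 by simp
  then show ?thesis unfolding polar_grassmannian_def dim_iff_rk submax_def by simp
qed

lemma perp_maxsing: assumes "maxsing M" shows "perp M = M"
proof
  have sM: "sing M" using assms by (rule maxsing_sing)
  show "M \<subseteq> perp M" using sM by (simp add: sing_iff clique_def)
  show "perp M \<subseteq> M"
  proof
    fix x assume "x \<in> perp M"
    then have "sing (span (insert x M))" by (rule sing_span_insert[OF sM])
    moreover have "M \<subseteq> span (insert x M)" by (auto intro: span_base)
    ultimately have "span (insert x M) = M"
      using assms unfolding maximal_singular_subspace_def by simp
    then show "x \<in> M" using span_base[of x "insert x M"] by simp
  qed
qed

lemma sing_Int_perp: "sing S \<Longrightarrow> X \<subseteq> P \<Longrightarrow> sing (S \<inter> perp X)"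
  by (simp add: sing_Int subsp_perp)

text \<open>A single point \<open>x\<close> of \<open>S\<close> outside \<open>perp {w}\<close>
  completes the section to a spanning set of \<open>S\<close>, because every line through
  \<open>x\<close> in \<open>S\<close> contains a point collinear with \<open>w\<close>.\<close>

lemma rk_cut:
  assumes S: "sing S" and w: "w \<in> P"
  shows "rk S \<le> Suc (rk (S \<inter> perp {w}))"
proof (cases "S \<subseteq> perp {w}")
  case True
  then show ?thesis by (simp add: Int_absorb2)
next
  case False
  then obtain x where x: "x \<in> S" "\<not> col w x" using sing_P[OF S] by (auto simp: perp_def)
  let ?H = "S \<inter> perp {w}"
  have H: "sing ?H" using S w by (simp add: sing_Int_perp)
  have xH: "x \<in> perp ?H" using sing_col[OF S] x sing_P[OF S] by (auto simp: perp_def)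
  have sx: "sing (span (insert x ?H))" using sing_span_insert H xH by blast
  have "S \<subseteq> span (insert x ?H)"
  proof
    fix z assume z: "z \<in> S"
    obtain l c where l: "l \<in> L" "x \<in> l" "z \<in> l" "c \<in> l" "col w c"
      using obtain_meet[OF w sing_col[OF S x(1) z]] by metis
    have cx: "x \<noteq> c" using l x by blast
    show "z \<in> span (insert x ?H)"
    proof (cases "z = x")
      case True then show ?thesis by (simp add: span_base)
    next
      case False
      have "l \<subseteq> S" using subsp_line[of S x z l] S x z False l by (simp add: sing_iff)
      then have "c \<in> ?H" using l line_in_P by (auto simp: perp_def)
      then have "l \<subseteq> span (insert x ?H)"
        using subsp_line[of "span (insert x ?H)" x c l] sx cx l by (simp add: sing_iff span_base)
      then show ?thesis using l by blast
    qed
  qed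
  then have "rk S \<le> rk (span (insert x ?H))" using rk_mono S sx by blast
  also have "\<dots> = Suc (rk ?H)"
    using rk_insert[OF H xH] x by (simp add: perp_def)
  finally show ?thesis .
qed

lemma rk_cut_set:
  assumes S: "sing S"
  shows "finite X \<Longrightarrow> X \<subseteq> P \<Longrightarrow> rk S \<le> rk (S \<inter> perp X) + card X"
proof (induction X rule: finite_induct)
  case empty
  have "S \<inter> perp {} = S" using sing_P[OF S] by (auto simp: perp_def)
  then show ?case by simp
next
  case (insert x X)
  have "S \<inter> perp (insert x X) = (S \<inter> perp X) \<inter> perp {x}" by (auto simp: perp_def)
  then show ?case using insert rk_cut[of "S \<inter> perp X" x] sing_Int_perp[OF S, of X] by simp
qed

text \<open>The rank drops by at most one by \<open>rk_cut\<close>, and it does drop, since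
  \<open>M\<close> is its own perp and \<open>w\<close> lies outside \<open>M\<close>.\<close>

lemma submax_cut:
  assumes M: "maxsing M" and w: "w \<in> P" "w \<notin> M"
  shows "submax (M \<inter> perp {w})"
proof -
  have sM: "sing M" "rk M = n" using M maxsing_iff_rk by auto
  have s: "sing (M \<inter> perp {w})" using sM w by (simp add: sing_Int_perp)
  have "\<not> M \<subseteq> perp {w}"
    using perp_galois[OF sing_P[OF sM(1)], of "{w}"] w perp_maxsing[OF M] by simp
  then have "rk (M \<inter> perp {w}) < rk M" using rk_less[OF s sM(1)] by blast
  then show ?thesis using rk_cut[OF sM(1) w(1)] sM s by (simp add: submax_def)
qed

lemma double_perp:
  assumes "sing S" "k \<in> P" "k \<notin> S"
  obtains w where "w \<in> perp S" "\<not> col w k"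
proof -
  obtain B where B: "indep B" "span B = S" using obtain_base assms by blast
  then have cB: "finite B" "clique B" by (auto simp: indep_def)
  show thesis
    using not_in_double_perp[OF cB assms(2)] perp_span[OF clique_P[OF cB(2)]] B assms that by auto
qed

lemma submax_eq: "submax S \<Longrightarrow> submax T \<Longrightarrow> S \<subseteq> T \<Longrightarrow> S = T"
  using eq_if_rk_le by (simp add: submax_def)

text \<open>Converse of \<open>submax_cut\<close>: a point \<open>w\<close> separating
  \<open>x\<close> from \<open>S\<close> cuts out of \<open>M\<close> a section that contains
  \<open>S\<close> and has the same rank.\<close>

lemma submax_form:
  assumes M: "maxsing M" and S: "submax S" "S \<subseteq> M" and x: "x \<in> M" "x \<notin> S"
  obtains w where "w \<in> P" "w \<in> perp S" "\<not> col w x" "w \<notin> M" "S = M \<inter> perp {w}"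
proof -
  have sM: "sing M" using M by (rule maxsing_sing)
  obtain w where w: "w \<in> perp S" "\<not> col w x"
    using double_perp[of S x] S x sing_P[OF sM] by (auto simp: submax_def)
  have wP: "w \<in> P" using w perp_P by blast
  have wM: "w \<notin> M" using w x sing_col[OF sM] by blast
  have "S \<subseteq> perp {w}" using w S sing_P[OF sM] by (auto simp: perp_def intro: col_sym)
  then have "S = M \<inter> perp {w}" using submax_eq[OF S(1) submax_cut[OF M wP wM]] S by blast
  then show thesis using that w wP wM by blast
qed

text \<open>\<open>S\<close> and \<open>x\<close> together span \<open>M\<close>, so
  \<open>z\<close> lies in the perp of \<open>M\<close>, which is \<open>M\<close> itself.\<close>

lemma in_max_if_perp:
  assumes M: "maxsing M" and S: "submax S" "S \<subseteq> M" and x: "x \<in> M" "x \<notin> S"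
    and z: "z \<in> perp S" "col x z"
  shows "z \<in> M"
proof -
  have sM: "sing M" "rk M = n" using M maxsing_iff_rk by auto
  have sS: "sing S" using S by (simp add: submax_def)
  have xS: "x \<in> perp S" using x S sing_col[OF sM(1)] sing_P[OF sM(1)] by (auto simp: perp_def)
  have "span (insert x S) \<subseteq> M" using span_subset_sing[OF sM(1)] x S by simp
  moreover have "rk M \<le> rk (span (insert x S))"
    using rk_insert[OF sS xS x(2)] S sM rank_ge_2 by (simp add: submax_def)
  ultimately have "span (insert x S) = M"
    using eq_if_rk_le sing_span_insert[OF sS xS] sM by blast
  moreover have "z \<in> perp (insert x S)" using z by (simp add: perp_insert)
  moreover have "insert x S \<subseteq> P" using sing_P[OF sM(1)] x S by blast
  ultimately show ?thesis using perp_span perp_maxsing[OF M] by metis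
qed

lemma rk_Int_submax:
  assumes M: "maxsing M" and R: "sing R" "R \<subseteq> M" and S: "submax S" "S \<subseteq> M"
  shows "rk R \<le> Suc (rk (R \<inter> S))"
proof -
  have "S \<noteq> M" using M S rank_ge_2 by (auto simp: submax_def maxsing_iff_rk)
  then obtain x where "x \<in> M" "x \<notin> S" using S by blast
  then obtain w where w: "w \<in> P" "S = M \<inter> perp {w}" using submax_form[OF M S, of x] by blast
  then have "R \<inter> S = R \<inter> perp {w}" using R by blast
  then show ?thesis using rk_cut R w by simp
qed

subsection \<open>Maximal subspaces and the Grassmann graph\<close>

abbreviation adj :: "('a set \<times> 'a set) set" where "adj \<equiv> polar_grassmann_adj P L n"

lemma adj_iff:
  "(S, T) \<in> adj \<longleftrightarrow> submax S \<and> submax T \<and> S \<noteq> T \<and> (\<exists>M. maxsing M \<and> S \<subseteq> M \<and> T \<subseteq> M)"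
  unfolding polar_grassmann_adj_def grassmannian_max grassmannian_submax by simp

lemma maxsing_P: "maxsing M \<Longrightarrow> M \<subseteq> P"
  using sing_P[OF maxsing_sing] .

lemma submax_P: "submax S \<Longrightarrow> S \<subseteq> P"
  by (simp add: submax_def sing_P)

lemma submax_ne: "submax S \<Longrightarrow> S \<noteq> {}"
  using rk_empty rank_ge_2 by (auto simp: submax_def)

lemma sing_subset_perp: "sing M \<Longrightarrow> X \<subseteq> M \<Longrightarrow> M \<subseteq> perp X"
  using sing_col[of M] sing_P[of M] by (auto simp: perp_def)

lemma max_not_subset_submax: "maxsing M \<Longrightarrow> submax S \<Longrightarrow> \<not> M \<subseteq> S"
  using rk_mono[of M S] rank_ge_2 by (auto simp: submax_def maxsing_iff_rk)

lemma maxsing_eq: "maxsing M \<Longrightarrow> maxsing N \<Longrightarrow> M \<subseteq> N \<Longrightarrow> M = N"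
  using eq_if_rk_le[of M N] by (simp add: maxsing_iff_rk)

lemma in_max_if_perp_two:
  assumes M: "maxsing M" and S: "submax S" "S \<subseteq> M" and T: "submax T" "T \<subseteq> M" and ne: "S \<noteq> T"
    and z: "z \<in> perp S" "z \<in> perp T"
  shows "z \<in> M"
proof -
  obtain x where x: "x \<in> T" "x \<notin> S" using submax_eq[OF T(1) S(1)] ne by blast
  then show ?thesis using in_max_if_perp[OF M S, of x z] T z by (auto simp: perp_def)
qed

lemma maximal_through:
  assumes "sing S" "x \<in> perp S"
  obtains M where "maxsing M" "S \<subseteq> M" "x \<in> M"
proof -
  obtain M where M: "maxsing M" "span (insert x S) \<subseteq> M"
    using maximal_exists[OF sing_span_insert[OF assms]] by blast
  have "insert x S \<subseteq> span (insert x S)" by (rule pls_span_superset)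
  then show thesis using that[of M] M by blast
qed

text \<open>A point of \<open>perp A\<close> that is not collinear with \<open>y\<close> cuts out
  the required section of \<open>M\<close>.\<close>

lemma separating_submax:
  assumes M: "maxsing M" and A: "sing A" "A \<subseteq> M" and y: "y \<in> M" "y \<notin> A"
  obtains S where "submax S" "A \<subseteq> S" "S \<subseteq> M" "y \<notin> S"
proof -
  obtain w where w: "w \<in> perp A" "\<not> col w y"
    using double_perp[of A y] A y maxsing_P[OF M] by blast
  have wP: "w \<in> P" using w perp_P by blast
  have wM: "w \<notin> M" using w y sing_col[OF maxsing_sing[OF M]] by blast
  have "A \<subseteq> perp {w}" using w A maxsing_P[OF M] by (auto simp: perp_def intro: col_sym)
  then show thesis
    using that[of "M \<inter> perp {w}"] submax_cut[OF M wP wM] A w by (auto simp: perp_def)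
qed

lemma submax_avoiding:
  assumes "maxsing M" "y \<in> M"
  obtains S where "submax S" "S \<subseteq> M" "y \<notin> S"
  using separating_submax[OF assms(1) sing_empty _ assms(2)] by blast

lemma submax_separating_points:
  assumes "maxsing M" "x \<in> M" "y \<in> M" "x \<noteq> y"
  obtains S where "submax S" "S \<subseteq> M" "x \<in> S" "y \<notin> S"
proof -
  have x: "x \<in> P" using maxsing_P[OF assms(1)] assms(2) by (rule subsetD)
  have "{x} \<subseteq> M" "y \<notin> {x}" using assms by auto
  then obtain S where "submax S" "{x} \<subseteq> S" "S \<subseteq> M" "y \<notin> S"
    using separating_submax[OF assms(1) sing_singleton[OF x] _ assms(3)] by metis
  then show thesis using that by simp
qed

lemma submax_containing:
  assumes "maxsing M" "x \<in> M"
  obtains S where "submax S" "S \<subseteq> M" "x \<in> S"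
proof -
  have x: "x \<in> P" using maxsing_P[OF assms(1)] assms(2) by (rule subsetD)
  have "rk {x} \<noteq> rk M" using rk_singleton[OF x] rank_ge_2 assms by (simp add: maxsing_iff_rk)
  then have "M \<noteq> {x}" by auto
  then obtain y where "y \<in> M" "x \<noteq> y" using assms by blast
  then show thesis using submax_separating_points[OF assms] that by blast
qed

lemma max_Int_max:
  assumes "maxsing M" "maxsing K" "M \<noteq> K" "submax S" "S \<subseteq> M" "S \<subseteq> K"
  shows "M \<inter> K = S"
proof -
  have s: "sing M" "sing K" using assms maxsing_sing by auto
  have i: "sing (M \<inter> K)" using s sing_Int by (simp add: sing_iff)
  have "M \<inter> K \<subset> M" using maxsing_eq assms by blast
  then have "rk (M \<inter> K) < n" using rk_less[OF i s(1)] assms by (simp add: maxsing_iff_rk)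
  then show ?thesis using eq_if_rk_le[of S "M \<inter> K"] i assms by (auto simp: submax_def)
qed

lemma other_maximal:
  assumes K: "maxsing K" and S: "submax S" "S \<subseteq> K"
  obtains M where "maxsing M" "S \<subseteq> M" "M \<noteq> K"
proof -
  obtain x where x: "x \<in> K" "x \<notin> S" using max_not_subset_submax[OF K S(1)] by blast
  obtain w where w: "w \<in> perp S" "w \<notin> K" using submax_form[OF K S x] by blast
  show thesis
    using maximal_through[of S w] S w that by (metis submax_def)
qed

section \<open>Maximal subspaces with prescribed intersection, and paths between maximal
  subspaces\<close>

lemma maximal_avoiding_step:
  assumes M: "maxsing M" and N: "maxsing N" and A: "sing A" "A \<subseteq> N"
    and x: "x \<in> N" "x \<notin> A" and xM: "x \<in> M"
  obtains N' where "maxsing N'" "A \<subseteq> N'" "N' \<inter> M \<subset> N \<inter> M"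
proof -
  have sN: "sing N" and sM: "sing M" using M N maxsing_sing by auto
  \<comment> \<open>The section \<open>?H\<close> of \<open>N\<close> by \<open>w\<close> contains
    \<open>A\<close> and misses \<open>x\<close>, and \<open>N'\<close> joins it to
    \<open>w\<close>. A common point of \<open>N'\<close> and \<open>M\<close> is collinear with all
    of \<open>?H\<close> and, inside \<open>M\<close>, with \<open>x\<close>, so it lies in
    \<open>N\<close>. Thus the intersection with \<open>M\<close> gains nothing and loses
    \<open>x\<close>.\<close>
  obtain w where w: "w \<in> perp A" "\<not> col w x"
    using double_perp[of A x] A x maxsing_P[OF N] by blast
  have wP: "w \<in> P" using w perp_P by blast
  have wN: "w \<notin> N" using w x sing_col[OF sN] by blast
  let ?H = "N \<inter> perp {w}"
  have H: "submax ?H" by (rule submax_cut[OF N wP wN])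
  have "w \<in> perp ?H" using wP by (auto simp: perp_def intro: col_sym)
  then obtain N' where N': "maxsing N'" "?H \<subseteq> N'" "w \<in> N'"
    using maximal_through[of ?H w] H by (auto simp: submax_def)
  have sN': "sing N'" using N' maxsing_sing by blast
  have AH: "A \<subseteq> ?H" using w A maxsing_P[OF N] by (auto simp: perp_def intro: col_sym)
  have xH: "x \<notin> ?H" using w by (auto simp: perp_def)
  have "N' \<inter> M \<subset> N \<inter> M"
  proof -
    have "z \<in> ?H" if z: "z \<in> N'" "z \<in> M" for z
    proof -
      have "z \<in> perp ?H" using sing_subset_perp[OF sN' N'(2)] z by blast
      then have "z \<in> N" using in_max_if_perp[OF N H _ x(1) xH] sing_col[OF sM xM z(2)] by blast
      moreover have "z \<in> perp {w}" using sing_col[OF sN' N'(3) z(1)] z maxsing_P[OF M] by (auto simp: perp_def)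
      ultimately show ?thesis by blast
    qed
    then show ?thesis using x xM xH by blast
  qed
  then show thesis using that[of N'] N' AH by blast
qed

text \<open>Among the maximal subspaces containing \<open>A\<close>, one whose intersection with
  \<open>M\<close> has least rank works, since \<open>maximal_avoiding_step\<close> would lower the
  rank further.\<close>

lemma maximal_avoiding:
  assumes M: "maxsing M" and A: "sing A" "A \<subseteq> M"
  obtains N where "maxsing N" "N \<inter> M = A"
proof -
  obtain N where N: "maxsing N \<and> A \<subseteq> N"
    and least: "\<forall>N'. maxsing N' \<and> A \<subseteq> N' \<longrightarrow> rk (N \<inter> M) \<le> rk (N' \<inter> M)"
    using ex_has_least_nat[of "\<lambda>N. maxsing N \<and> A \<subseteq> N" M "\<lambda>N. rk (N \<inter> M)"] M A by blast
  have sI: "sing (N \<inter> M)" if "maxsing N" for N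
    using that M maxsing_sing sing_Int by (simp add: sing_iff)
  have "N \<inter> M \<subseteq> A"
  proof (rule ccontr)
    assume "\<not> ?thesis"
    then obtain x where x: "x \<in> N" "x \<in> M" "x \<notin> A" by blast
    obtain N' where "maxsing N'" "A \<subseteq> N'" "N' \<inter> M \<subset> N \<inter> M"
      using maximal_avoiding_step[OF M conjunct1[OF N] A(1) conjunct2[OF N] x(1,3,2)] by blast
    then show False using least rk_less[OF sI sI, of N' N] N by (metis not_le)
  qed
  then show thesis using that N A by blast
qed

text \<open>\<open>M'\<close> contains a point \<open>x\<close> of \<open>N\<close> outside
  \<open>M\<close> together with all points of \<open>M\<close> collinear with \<open>x\<close>;
  these include \<open>M \<inter> N\<close>. Iteration yields a path from \<open>M\<close> to
  \<open>N\<close>.\<close>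

lemma dual_step:
  assumes M: "maxsing M" and N: "maxsing N" and ne: "M \<noteq> N"
  obtains M' where "maxsing M'" "submax (M \<inter> M')" "M' \<noteq> M" "M \<inter> N \<subseteq> M'" "rk (M \<inter> N) < rk (M' \<inter> N)"
proof -
  have s: "sing M" "sing N" using M N maxsing_sing by auto
  obtain x where x: "x \<in> N" "x \<notin> M" using maxsing_eq[OF N M] ne by blast
  have xP: "x \<in> P" using x maxsing_P[OF N] by blast
  let ?H = "M \<inter> perp {x}"
  have H: "submax ?H" by (rule submax_cut[OF M xP x(2)])
  have "x \<in> perp ?H" using xP by (auto simp: perp_def intro: col_sym)
  then obtain M' where M': "maxsing M'" "?H \<subseteq> M'" "x \<in> M'"
    using maximal_through[of ?H x] H by (auto simp: submax_def)
  have MM': "M' \<noteq> M" using M' x by blast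
  have "M \<inter> M' = ?H" using max_Int_max[OF M M'(1) _ H] MM' M' by blast
  moreover have i: "M \<inter> N \<subseteq> M'" using M' sing_subset_perp[OF s(2), of "{x}"] x by blast
  moreover have "M \<inter> N \<subset> M' \<inter> N" using i x M' by blast
  moreover have "sing (M \<inter> N)" "sing (M' \<inter> N)"
    using s M' maxsing_sing sing_Int by (simp_all add: sing_iff)
  ultimately show thesis using that[of M'] M' H MM' rk_less by simp
qed

text \<open>All points of a line through \<open>x\<close> and \<open>y\<close> would be collinear
  with \<open>T\<close>, and one of them also with a point \<open>t\<close> of \<open>N\<close>
  outside \<open>T\<close>. That one would lie in both \<open>M\<close> and
  \<open>N\<close>.\<close>

lemma unique_perp_of_disjoint:
  assumes M: "maxsing M" and N: "maxsing N" and disj: "M \<inter> N = {}"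
    and T: "submax T" "T \<subseteq> N" and x: "x \<in> M" "x \<in> perp T" and y: "y \<in> M" "y \<in> perp T"
  shows "x = y"
proof (rule ccontr)
  assume ne: "x \<noteq> y"
  have sM: "sing M" using M by (rule maxsing_sing)
  obtain t where t: "t \<in> N" "t \<notin> T" using max_not_subset_submax[OF N T(1)] by blast
  have tP: "t \<in> P" using t maxsing_P[OF N] by blast
  obtain l z where l: "l \<in> L" "x \<in> l" "y \<in> l" "z \<in> l" "col t z"
    using obtain_meet[OF tP sing_col[OF sM x(1) y(1)]] by metis
  have "z \<in> perp T" using perp_line[of T l x y z] submax_P[OF T(1)] l ne x y by blast
  then have "z \<in> N" using in_max_if_perp[OF N T t] l by blast
  moreover have "z \<in> M" using subsp_line[of M x y l] sM x y ne l by (auto simp: sing_iff)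
  ultimately show False using disj by blast
qed

section \<open>Nearness as a bound on the graph distance\<close>

definition near :: "'a set \<Rightarrow> 'a set \<Rightarrow> bool" where
  "near S T \<longleftrightarrow> (\<exists>s\<in>S. s \<in> perp T)"

text \<open>Passing from \<open>M\<close> to the next maximal subspace \<open>N\<close> along the
  vertex \<open>R\<close> keeps the part of \<open>S \<inter> M\<close> inside \<open>R\<close>,
  which costs at most one rank.\<close>

lemma walk_meets_maximal:
  assumes "submax S"
  shows "(S, T) \<in> adj ^^ Suc k \<Longrightarrow> \<exists>M. maxsing M \<and> T \<subseteq> M \<and> n - 1 \<le> rk (S \<inter> M) + k"
proof (induction k arbitrary: T)
  case 0
  then obtain M where "maxsing M" "S \<subseteq> M" "T \<subseteq> M" by (auto simp: adj_iff)
  then show ?case using assms by (auto simp: submax_def Int_absorb2)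
next
  case (Suc k)
  then obtain R where R: "(S, R) \<in> adj ^^ Suc k" "(R, T) \<in> adj" by (auto elim: relpow_Suc_E)
  obtain M where M: "maxsing M" "R \<subseteq> M" "n - 1 \<le> rk (S \<inter> M) + k" using Suc.IH R by blast
  obtain N where N: "maxsing N" "R \<subseteq> N" "T \<subseteq> N" and r: "submax R" using R by (auto simp: adj_iff)
  have s: "sing S" "subsp M" "subsp R" "subsp N" using assms M N r maxsing_sing by (auto simp: submax_def sing_iff)
  have "rk (S \<inter> M) \<le> Suc (rk (S \<inter> M \<inter> R))"
    using rk_Int_submax[OF M(1) _ _ r M(2)] sing_Int[OF s(1,2)] by blast
  also have "rk (S \<inter> M \<inter> R) \<le> rk (S \<inter> N)"
    using rk_mono[of "S \<inter> M \<inter> R" "S \<inter> N"] s sing_Int N by blast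
  finally show ?case using M N by auto
qed

text \<open>Each \<open>dual_step\<close> costs at most one edge, from \<open>S\<close> to
  \<open>M \<inter> M'\<close> inside \<open>M\<close>. The extra \<open>1\<close> pays for the last
  edge to \<open>T\<close> inside \<open>N\<close>.\<close>

lemma walk_between_maximals:
  assumes N: "maxsing N" and T: "submax T" "T \<subseteq> N"
  shows "\<lbrakk>maxsing M; submax S; S \<subseteq> M; n \<le> rk (M \<inter> N) + j\<rbrakk> \<Longrightarrow> \<exists>k\<le>j + 1. (S, T) \<in> adj ^^ k"
proof (induction j arbitrary: M S)
  case same: 0
  have s: "sing M" "sing N" "sing (M \<inter> N)"
    using same N maxsing_sing sing_Int[of M N] by (simp_all add: sing_iff)
  have "M \<inter> N = M" "M \<inter> N = N"
    using eq_if_rk_le[OF s(3,1)] eq_if_rk_le[OF s(3,2)] rk_le[OF s(1)] rk_le[OF s(2)] same by auto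
  then have MN: "M = N" by blast
  show ?case
  proof (cases "S = T")
    case True then show ?thesis by (intro exI[of _ 0]) simp
  next
    case False
    then have "(S, T) \<in> adj" using same T MN by (auto simp: adj_iff)
    then show ?thesis by (intro exI[of _ 1]) simp
  qed
next
  case (Suc j)
  show ?case
  proof (cases "M = N")
    case True
    show ?thesis
    proof (cases "S = T")
      case True then show ?thesis by (intro exI[of _ 0]) simp
    next
      case False
      then have "(S, T) \<in> adj" using Suc.prems T True by (auto simp: adj_iff)
      then show ?thesis by (intro exI[of _ 1]) simp
    qed
  next
    case False
    obtain M' where M': "maxsing M'" "submax (M \<inter> M')" "rk (M \<inter> N) < rk (M' \<inter> N)"
      using dual_step[OF Suc.prems(1) N False] by blast
    have "n \<le> rk (M' \<inter> N) + j" using M' Suc.prems by simp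
    then obtain k where k: "k \<le> j + 1" "(M \<inter> M', T) \<in> adj ^^ k"
      using Suc.IH[OF M'(1,2)] by blast
    show ?thesis
    proof (cases "S = M \<inter> M'")
      case True then show ?thesis using k by (intro exI[of _ k]) simp
    next
      case False
      then have "(S, M \<inter> M') \<in> adj" using Suc.prems M' by (auto simp: adj_iff)
      then have "(S, T) \<in> adj ^^ Suc k" using k relpow_Suc_I2 by metis
      then show ?thesis using k by (intro exI[of _ "Suc k"]) simp
    qed
  qed
qed

lemma near_iff_walk:
  assumes S: "submax S" and T: "submax T"
  shows "near S T \<longleftrightarrow> (\<exists>k\<le>n - 1. (S, T) \<in> adj ^^ k)"
proof
  assume "\<exists>k\<le>n - 1. (S, T) \<in> adj ^^ k"
  then obtain k where k: "k \<le> n - 1" "(S, T) \<in> adj ^^ k" by blast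
  show "near S T"
  proof (cases k)
    case 0
    then have "S = T" using k by simp
    moreover obtain s where "s \<in> S" using submax_ne[OF S] by blast
    ultimately show ?thesis using S sing_subset_perp[of S S] by (auto simp: near_def submax_def)
  next
    case (Suc j)
    obtain M where M: "maxsing M" "T \<subseteq> M" "n - 1 \<le> rk (S \<inter> M) + j"
      using walk_meets_maximal[OF S] k Suc by blast
    \<comment> \<open>As \<open>k = j + 1 \<le> n - 1\<close>, the rank bound
      \<open>n - 1 - j\<close> is at least \<open>1\<close>.\<close>
    then have "rk (S \<inter> M) \<noteq> 0" using k Suc rank_ge_2 by simp
    then have "S \<inter> M \<noteq> {}" using rk_empty by auto
    then show ?thesis using sing_subset_perp[OF maxsing_sing[OF M(1)] M(2)] by (auto simp: near_def)
  qed
next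
  assume "near S T"
  then obtain s where s: "s \<in> S" "s \<in> perp T" by (auto simp: near_def)
  have sP: "s \<in> P" using s perp_P by blast
  have sS: "sing S" "rk S = n - 1" and sT: "sing T" using S T by (auto simp: submax_def)
  obtain N where N: "maxsing N" "T \<subseteq> N" "s \<in> N" using maximal_through[OF sT s(2)] by blast
  have sN: "sing N" "rk N = n" using N maxsing_iff_rk by auto
  obtain B where B: "indep B" "{s} \<subseteq> B" "B \<subseteq> S" "span B = S"
    using base_extend[OF sS(1) indep_singleton[OF sP]] s by blast
  have cB: "finite B" "clique B" "card B = n - 1" using B rk_span sS by (auto simp: indep_def)
  let ?X = "B - {s}"
  have BP: "B \<subseteq> P" using clique_P cB by blast
  have cX: "card ?X = n - 2" using cB B by simp
  \<comment> \<open>Only the \<open>n - 2\<close> base points other than \<open>s\<close> have to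
    cut down \<open>N\<close>, because \<open>s\<close> already lies in \<open>N\<close>. The
    remaining rank of at least \<open>2\<close> leaves a point \<open>p\<close> besides
    \<open>s\<close> that is collinear with all of \<open>S\<close>.\<close>
  have "n \<le> rk (N \<inter> perp ?X) + (n - 2)"
    using rk_cut_set[OF sN(1), of ?X] cB cX BP sN by auto
  then have r2: "2 \<le> rk (N \<inter> perp ?X)" using rank_ge_2 by simp
  have "\<not> N \<inter> perp ?X \<subseteq> {s}"
  proof
    assume "N \<inter> perp ?X \<subseteq> {s}"
    moreover have "sing (N \<inter> perp ?X)" using sing_Int_perp[OF sN(1), of ?X] BP by blast
    ultimately have "rk (N \<inter> perp ?X) \<le> 1"
      using rk_mono[OF _ sing_singleton[OF sP]] rk_singleton[OF sP] by simp
    then show False using r2 by simp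
  qed
  then obtain p where p: "p \<in> N" "p \<in> perp ?X" "p \<noteq> s" by blast
  have "p \<in> perp B" using p sing_col[OF sN(1) N(3) p(1)] by (auto simp: perp_def)
  then have "p \<in> perp S" using perp_span[OF BP] B by simp
  then obtain M where M: "maxsing M" "S \<subseteq> M" "p \<in> M" using maximal_through[OF sS(1)] by blast
  have "sing (M \<inter> N)" using M N maxsing_sing sing_Int by (simp add: sing_iff)
  moreover have "{s} \<subset> M \<inter> N" using s M N p by blast
  ultimately have "1 < rk (M \<inter> N)"
    using rk_less[OF sing_singleton[OF sP]] rk_singleton[OF sP] by metis
  \<comment> \<open>\<open>M\<close> and \<open>N\<close> share \<open>s\<close> and
    \<open>p\<close>, so a walk along \<open>n - 2\<close> dual steps is available.\<close>
  then have "n \<le> rk (M \<inter> N) + (n - 2)" by simp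
  then show "\<exists>k\<le>n - 1. (S, T) \<in> adj ^^ k"
    using walk_between_maximals[OF N(1) T N(2) M(1) S M(2), of "n - 2"] rank_ge_2
    by (simp add: Suc_diff_Suc numeral_2_eq_2)
qed

section \<open>Triangles and quadrangles in the Grassmann graph\<close>

lemma adj_triangle:
  assumes M: "maxsing M" "S \<subseteq> M" "T \<subseteq> M" and a: "(S, T) \<in> adj" "(R, S) \<in> adj" "(R, T) \<in> adj"
  shows "R \<subseteq> M"
proof
  fix r assume r: "r \<in> R"
  have "r \<in> perp S" "r \<in> perp T"
    using a(2,3) r sing_subset_perp[OF maxsing_sing] unfolding adj_iff by blast+
  then show "r \<in> M" using in_max_if_perp_two[OF M(1) _ M(2) _ M(3)] a(1) by (auto simp: adj_iff)
qed

text \<open>A point of \<open>U \<inter> S\<close> is collinear with all of \<open>V\<close> and of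
  \<open>W\<close>, hence lies in the maximal subspace \<open>M3\<close> on these two. As
  \<open>S\<close> and \<open>W\<close> are not adjacent, \<open>M3\<close> differs from the maximal
  subspace on \<open>S\<close> and \<open>V\<close>, and the two meet exactly in
  \<open>V\<close>.\<close>

lemma quadrangle_Int:
  assumes a: "(U, S) \<in> adj" "(S, V) \<in> adj" "(V, W) \<in> adj" "(W, U) \<in> adj"
    and na: "(S, W) \<notin> adj" "S \<noteq> W"
  shows "U \<inter> S \<subseteq> V"
proof
  fix x assume x: "x \<in> U \<inter> S"
  obtain M2 where M2: "maxsing M2" "S \<subseteq> M2" "V \<subseteq> M2" using a by (auto simp: adj_iff)
  obtain M3 where M3: "maxsing M3" "V \<subseteq> M3" "W \<subseteq> M3" using a by (auto simp: adj_iff)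
  obtain M4 where M4: "maxsing M4" "W \<subseteq> M4" "U \<subseteq> M4" using a by (auto simp: adj_iff)
  have sm: "submax S" "submax V" "submax W" "V \<noteq> W" using a by (auto simp: adj_iff)
  have "x \<in> perp V" using sing_subset_perp[OF maxsing_sing[OF M2(1)] M2(3)] M2 x by blast
  moreover have "x \<in> perp W" using sing_subset_perp[OF maxsing_sing[OF M4(1)] M4(2)] M4 x by blast
  ultimately have "x \<in> M3" using in_max_if_perp_two[OF M3(1) sm(2) M3(2) sm(3) M3(3)] sm by blast
  moreover have "M3 \<noteq> M2" using na M2 M3 sm by (auto simp: adj_iff)
  ultimately show "x \<in> V" using max_Int_max[OF M2(1) M3(1) _ sm(2) M2(3) M3(2)] M2 x by blast
qed

text \<open>Provides quadrangles for \<open>quadrangle_Int\<close> whose vertex \<open>U\<close>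
  through \<open>p\<close> lies in \<open>M\<close>, so that incidence with \<open>V\<close> in
  \<open>K\<close> can be read off from vertices in \<open>M\<close>.\<close>

lemma quadrangle_exists:
  assumes M: "maxsing M" and K: "maxsing K" and S: "submax (M \<inter> K)"
    and V: "submax V" "V \<subseteq> K" "V \<noteq> M \<inter> K" and p: "p \<in> V" "p \<in> M"
  obtains U W where "U \<subseteq> M" "p \<in> U" "(U, M \<inter> K) \<in> adj" "(M \<inter> K, V) \<in> adj" "(V, W) \<in> adj"
    "(W, U) \<in> adj" "(M \<inter> K, W) \<notin> adj" "M \<inter> K \<noteq> W"
proof -
  let ?S = "M \<inter> K" and ?A = "V \<inter> (M \<inter> K)"
  have sM: "sing M" and sV: "sing V" and sS: "sing ?S"
    using M V S maxsing_sing by (auto simp: submax_def)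
  have A: "sing ?A" using sing_Int[OF sV] sS by (simp add: sing_iff)
  have "rk ?S \<le> Suc (rk (?S \<inter> V))" using rk_Int_submax[OF K sS _ V(1,2)] by blast
  moreover have "rk ?A < rk ?S"
    using rk_less[OF A sS] submax_eq[OF S V(1)] V(3) by blast
  ultimately have rA: "Suc (rk ?A) = n - 1" using S by (simp add: submax_def Int_ac)
  obtain M3 where M3: "maxsing M3" "V \<subseteq> M3" "M3 \<noteq> K" using other_maximal[OF K V(1,2)] by blast
  have M3K: "M3 \<inter> K = V" using max_Int_max[OF M3(1) K M3(3) V(1) M3(2) V(2)] .
  obtain a where a: "a \<in> M" "a \<notin> ?S" using max_not_subset_submax[OF M S] by blast
  have aP: "a \<in> P" using a maxsing_P[OF M] by blast
  have aS: "a \<in> perp ?S" using sing_subset_perp[OF sM, of ?S] a by blast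
  have aV: "a \<notin> perp V" using in_max_if_perp_two[OF K V(1,2) S _ V(3)] aS a by blast
  have aM3: "a \<notin> M3" using aV sing_subset_perp[OF maxsing_sing[OF M3(1)] M3(2)] by blast
  \<comment> \<open>\<open>?W\<close> lies with \<open>V\<close> in a second maximal subspace
    \<open>M3\<close>. Being collinear with \<open>a\<close> and containing \<open>?A\<close>, it
    also shares a maximal subspace with the span of \<open>a\<close> and \<open>?A\<close>, which
    becomes \<open>U\<close>.\<close>
  let ?W = "M3 \<inter> perp {a}"
  have W: "submax ?W" by (rule submax_cut[OF M3(1) aP aM3])
  have aW: "a \<in> perp ?W" using aP by (auto simp: perp_def intro: col_sym)
  have AW: "?A \<subseteq> ?W" using M3 sing_subset_perp[OF sM, of "{a}"] a by blast
  have "V \<noteq> ?W" using aW aV by auto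
  \<comment> \<open>\<open>c\<close> prevents \<open>?W\<close> from being adjacent to
    \<open>?S\<close>: it lies outside \<open>K\<close> and is collinear with all of
    \<open>V\<close>, so it cannot be collinear with all of \<open>?S\<close> as well.\<close>
  then obtain c where c: "c \<in> ?W" "c \<notin> V" using submax_eq[OF W V(1)] by blast
  have cV: "c \<in> perp V" using sing_subset_perp[OF maxsing_sing[OF M3(1)] M3(2)] c by blast
  have cK: "c \<notin> K" using c M3K by blast
  have cS: "c \<notin> perp ?S" using in_max_if_perp_two[OF K V(1,2) S _ V(3) cV] cK by blast
  let ?U = "span (insert a ?A)"
  have aA: "a \<in> perp ?A" using aS perp_anti[of ?A ?S] by blast
  have U: "submax ?U"
    using sing_span_insert[OF A aA] rk_insert[OF A aA] a rA by (simp add: submax_def)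
  have "insert a ?A \<subseteq> M" using a by blast
  then have UM: "?U \<subseteq> M" by (rule span_subset_sing[OF sM])
  have aU: "a \<in> ?U" by (simp add: span_base)
  obtain M4 where M4: "maxsing M4" "?W \<subseteq> M4" "a \<in> M4"
    using maximal_through[OF _ aW] W by (auto simp: submax_def)
  have "insert a ?A \<subseteq> M4" using M4 AW by blast
  then have UM4: "?U \<subseteq> M4" by (rule span_subset_sing[OF maxsing_sing[OF M4(1)]])
  show thesis
  proof
    show "?U \<subseteq> M" by (rule UM)
    show "p \<in> ?U" using p V by (auto intro: span_base)
    show "(?U, ?S) \<in> adj" using U S UM M a aU unfolding adj_iff by blast
    show "(?S, V) \<in> adj" using S V K unfolding adj_iff by blast
    show "(V, ?W) \<in> adj" using V W M3 \<open>V \<noteq> ?W\<close> unfolding adj_iff by blast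
    show "(?W, ?U) \<in> adj" using W U M4 UM4 aM3 aU unfolding adj_iff by blast
    show "?S \<noteq> ?W" using c cK by blast
    show "(?S, ?W) \<notin> adj"
    proof
      assume "(?S, ?W) \<in> adj"
      then obtain M5 where "maxsing M5" "?S \<subseteq> M5" "?W \<subseteq> M5" unfolding adj_iff by blast
      then show False using sing_subset_perp[OF maxsing_sing, of M5 ?S] c cS by blast
    qed
  qed
qed

section \<open>Projection onto a disjoint maximal subspace, and auxiliary choices\<close>

lemma near_projection:
  assumes M: "maxsing M" and N: "maxsing N" and disj: "M \<inter> N = {}" and p: "p \<in> M"
    and S: "submax S" "S \<subseteq> M"
  shows "submax (N \<inter> perp {p})" "near S (N \<inter> perp {p}) \<longleftrightarrow> p \<in> S"
proof -
  have pP: "p \<in> P" and pN: "p \<notin> N" using p disj maxsing_P[OF M] by auto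
  let ?T = "N \<inter> perp {p}"
  show T: "submax ?T" by (rule submax_cut[OF N pP pN])
  have pT: "p \<in> perp ?T" using pP by (auto simp: perp_def intro: col_sym)
  show "near S ?T \<longleftrightarrow> p \<in> S"
  proof
    assume "near S ?T"
    then obtain s where s: "s \<in> S" "s \<in> perp ?T" by (auto simp: near_def)
    have "s = p" using unique_perp_of_disjoint[OF M N disj T _ _ s(2) p pT] s S by blast
    then show "p \<in> S" using s by simp
  qed (use pT in \<open>auto simp: near_def\<close>)
qed

lemma base_submax:
  assumes M: "maxsing M" and C: "indep C" "span C = M" and b: "b \<in> C"
  shows "submax (span (C - {b}))" "span (C - {b}) \<subseteq> M" "b \<notin> span (C - {b})"
proof -
  have i: "indep (C - {b})" using C indep_subset by blast
  have "card C = n" using rk_span[OF C(1)] C M by (simp add: maxsing_iff_rk)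
  then have "card (C - {b}) = n - 1" using b C by (simp add: indep_def)
  then show "submax (span (C - {b}))"
    using rk_span[OF i] clique_span i by (simp add: submax_def indep_def)
  show "span (C - {b}) \<subseteq> M" using pls_span_mono[of "C - {b}" C] C by blast
  show "b \<notin> span (C - {b})" using C b by (simp add: indep_def)
qed

lemma maximal_through_point:
  assumes "p \<in> P" obtains M where "maxsing M" "p \<in> M"
  using maximal_exists[OF sing_singleton[OF assms]] by blast

lemma maximal_of_submax:
  assumes "submax S" obtains M where "maxsing M" "S \<subseteq> M"
proof -
  have "sing S" using assms by (simp add: submax_def)
  then show thesis using maximal_exists that by blast
qed

text \<open>\<open>N0\<close> contains \<open>q\<close> and all points of \<open>M\<close> collinear
  with \<open>q\<close>. If \<open>N\<close> meets \<open>N0\<close> only in \<open>q\<close>, then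
  every point of \<open>M \<inter> N\<close> is collinear with \<open>q\<close>, hence lies in
  \<open>N0\<close> and equals \<open>q\<close>, which is not in \<open>M\<close>.\<close>

lemma disjoint_maximal_through:
  assumes M: "maxsing M" and q: "q \<in> P" "q \<notin> M"
  obtains N where "maxsing N" "q \<in> N" "M \<inter> N = {}"
proof -
  let ?H = "M \<inter> perp {q}"
  have H: "sing ?H" using submax_cut[OF M q] by (simp add: submax_def)
  have "q \<in> perp ?H" using q by (auto simp: perp_def intro: col_sym)
  then obtain N0 where N0: "maxsing N0" "?H \<subseteq> N0" "q \<in> N0" using maximal_through[OF H] by blast
  obtain N where N: "maxsing N" "N \<inter> N0 = {q}"
    using maximal_avoiding[OF N0(1) sing_singleton[OF q(1)]] N0(3) by blast
  have qN: "q \<in> N" using N by blast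
  have "N \<subseteq> perp {q}" using sing_subset_perp[OF maxsing_sing[OF N(1)], of "{q}"] qN by blast
  then have "M \<inter> N \<subseteq> N \<inter> N0" using N0(2) by blast
  then have "M \<inter> N = {}" using N(2) q(2) by auto
  then show thesis using that N qN by blast
qed

end

subsection \<open>Isometric embeddings\<close>

locale polar_embedding =
  src: polar_geometry P L n + tgt: polar_geometry P' L' n
  for P :: "'a set" and L :: "'a set set" and P' :: "'b set" and L' :: "'b set set" and n :: nat +
  fixes f :: "'a set \<Rightarrow> 'b set"
  assumes iso: "isometric_embedding
      (polar_grassmannian P L (n - 2)) (polar_grassmann_adj P L n)
      (polar_grassmannian P' L' (n - 2)) (polar_grassmann_adj P' L' n) f"
begin

lemma f_submax: "src.submax S \<Longrightarrow> tgt.submax (f S)"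
  using iso unfolding isometric_embedding_def src.grassmannian_submax tgt.grassmannian_submax
  by blast

lemma f_inj: "src.submax S \<Longrightarrow> src.submax T \<Longrightarrow> f S = f T \<Longrightarrow> S = T"
  using iso unfolding isometric_embedding_def src.grassmannian_submax
  by (simp add: inj_on_def)

lemma f_walk:
  assumes "src.submax S" "src.submax T"
  shows "(\<exists>k\<le>m. (f S, f T) \<in> tgt.adj ^^ k) \<longleftrightarrow> (\<exists>k\<le>m. (S, T) \<in> src.adj ^^ k)"
proof -
  have "graph_dist tgt.adj (f S) (f T) = graph_dist src.adj S T"
    using iso assms unfolding isometric_embedding_def src.grassmannian_submax by simp
  then show ?thesis unfolding graph_dist_le_iff[symmetric] by simp
qed

lemma f_near: "src.submax S \<Longrightarrow> src.submax T \<Longrightarrow> tgt.near (f S) (f T) \<longleftrightarrow> src.near S T"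
  using src.near_iff_walk tgt.near_iff_walk f_walk f_submax by simp

lemma f_adj:
  assumes "src.submax S" "src.submax T"
  shows "(f S, f T) \<in> tgt.adj \<longleftrightarrow> (S, T) \<in> src.adj"
proof -
  have "f S = f T \<or> (f S, f T) \<in> tgt.adj \<longleftrightarrow> S = T \<or> (S, T) \<in> src.adj"
    using f_walk[OF assms, of 1] unfolding walk_le_1 .
  then show ?thesis using f_inj[OF assms] src.adj_iff tgt.adj_iff by metis
qed

section \<open>The map induced on maximal subspaces\<close>

lemma maximal_image:
  assumes M: "src.maxsing M"
  shows "\<exists>M'. tgt.maxsing M' \<and> (\<forall>S. src.submax S \<longrightarrow> S \<subseteq> M \<longrightarrow> f S \<subseteq> M')"
proof -
  have "M \<noteq> {}" using M src.rk_empty src.rank_ge_2 by (auto simp: src.maxsing_iff_rk)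
  then obtain x where x: "x \<in> M" by blast
  \<comment> \<open>A point \<open>x\<close> serves to obtain two distinct vertices \<open>S\<close>
    and \<open>T\<close> in \<open>M\<close>. Any third vertex in \<open>M\<close> is adjacent to
    both, so \<open>adj_triangle\<close> traps its image in the same maximal subspace.\<close>
  obtain S where S: "src.submax S" "S \<subseteq> M" "x \<in> S" using src.submax_containing[OF M x] .
  obtain T where T: "src.submax T" "T \<subseteq> M" "x \<notin> T" using src.submax_avoiding[OF M x] .
  have adj: "(R, Q) \<in> src.adj"
    if "src.submax R" "R \<subseteq> M" "src.submax Q" "Q \<subseteq> M" "R \<noteq> Q" for R Q
    unfolding src.adj_iff using that M by blast
  have ST: "(f S, f T) \<in> tgt.adj" using adj[of S T] S T f_adj by blast
  then obtain M' where M': "tgt.maxsing M'" "f S \<subseteq> M'" "f T \<subseteq> M'" unfolding tgt.adj_iff by blast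
  have "f R \<subseteq> M'" if R: "src.submax R" "R \<subseteq> M" for R
  proof (cases "R = S \<or> R = T")
    case True then show ?thesis using M' by blast
  next
    case False
    then have "(f R, f S) \<in> tgt.adj" "(f R, f T) \<in> tgt.adj"
      using adj[of R S] adj[of R T] R S T f_adj by simp_all
    then show ?thesis using tgt.adj_triangle[OF M' ST] by blast
  qed
  then show ?thesis using M' by blast
qed

definition g :: "'a set \<Rightarrow> 'b set" where
  "g M = (SOME M'. tgt.maxsing M' \<and> (\<forall>S. src.submax S \<longrightarrow> S \<subseteq> M \<longrightarrow> f S \<subseteq> M'))"

lemma g_max: "src.maxsing M \<Longrightarrow> tgt.maxsing (g M)"
  and f_subset_g: "src.maxsing M \<Longrightarrow> src.submax S \<Longrightarrow> S \<subseteq> M \<Longrightarrow> f S \<subseteq> g M"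
  using someI_ex[OF maximal_image, of M] unfolding g_def by simp_all

lemma g_perp: "src.maxsing M \<Longrightarrow> X \<subseteq> g M \<Longrightarrow> g M \<subseteq> tgt.perp X"
  using tgt.sing_subset_perp[OF tgt.maxsing_sing[OF g_max]] .

text \<open>A common point would be collinear with the image of every submaximal subspace of
  \<open>N\<close>, but the projection of a point of \<open>M\<close> outside \<open>S\<close> is
  not near \<open>S\<close>.\<close>

lemma f_disjoint_g:
  assumes M: "src.maxsing M" and N: "src.maxsing N" and disj: "M \<inter> N = {}"
    and S: "src.submax S" "S \<subseteq> M"
  shows "f S \<inter> g N = {}"
proof (rule ccontr)
  assume "\<not> ?thesis"
  then obtain a where a: "a \<in> f S" "a \<in> g N" by blast
  obtain p where p: "p \<in> M" "p \<notin> S" using src.max_not_subset_submax[OF M S(1)] by blast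
  let ?T = "N \<inter> src.perp {p}"
  note T = src.near_projection[OF M N disj p(1) S]
  have "f ?T \<subseteq> g N" using f_subset_g[OF N T(1)] by blast
  then have "tgt.near (f S) (f ?T)" using a g_perp[OF N] by (auto simp: tgt.near_def)
  then show False using f_near[OF S(1) T(1)] T(2) p by blast
qed

text \<open>Since \<open>g M\<close> might have points outside all \<open>f S\<close>, a common
  point \<open>a\<close> is used to pull a point \<open>s\<close> of some \<open>f S\<close> into
  \<open>g N\<close>: \<open>s\<close> is collinear with \<open>a\<close> and with all of
  \<open>f ?T\<close>, where \<open>a\<close> is not in \<open>f ?T\<close>. This contradicts
  \<open>f_disjoint_g\<close>.\<close>

lemma g_disjoint:
  assumes M: "src.maxsing M" and N: "src.maxsing N" and disj: "M \<inter> N = {}"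
  shows "g M \<inter> g N = {}"
proof (rule ccontr)
  assume "\<not> ?thesis"
  then obtain a where a: "a \<in> g M" "a \<in> g N" by blast
  have "M \<noteq> {}" using M src.rk_empty src.rank_ge_2 by (auto simp: src.maxsing_iff_rk)
  then obtain p where p: "p \<in> M" by blast
  obtain S where S: "src.submax S" "S \<subseteq> M" "p \<in> S" using src.submax_containing[OF M p] .
  let ?T = "N \<inter> src.perp {p}"
  note T = src.near_projection[OF M N disj p S(1,2)]
  have "tgt.near (f S) (f ?T)" using f_near[OF S(1) T(1)] T(2) S by blast
  then obtain s where s: "s \<in> f S" "s \<in> tgt.perp (f ?T)" by (auto simp: tgt.near_def)
  have aT: "a \<notin> f ?T" using f_disjoint_g[OF N M _ T(1)] disj a by blast
  have sM: "s \<in> g M" using f_subset_g[OF M S(1,2)] s by blast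
  have "pls_collinear L' a s" by (rule tgt.sing_col[OF tgt.maxsing_sing[OF g_max[OF M]] a(1) sM])
  then have "s \<in> g N"
    using tgt.in_max_if_perp[OF g_max[OF N] f_submax[OF T(1)] _ a(2) aT s(2)] f_subset_g[OF N T(1)]
    by blast
  then show False using f_disjoint_g[OF M N disj S(1,2)] s by blast
qed

section \<open>The image of a point relative to a maximal subspace\<close>

definition is_image :: "'a set \<Rightarrow> 'a \<Rightarrow> 'b \<Rightarrow> bool" where
  "is_image M p x \<longleftrightarrow> x \<in> g M \<and> (\<forall>S. src.submax S \<longrightarrow> S \<subseteq> M \<longrightarrow> (x \<in> f S \<longleftrightarrow> p \<in> S))"

text \<open>Nearness to \<open>f ?T\<close> singles out one point of \<open>g M\<close>. Its
  collinearity with \<open>f ?T\<close> is recorded for the proof of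
  \<open>h_not_collinear\<close>.\<close>

lemma is_image_via_disjoint:
  assumes M: "src.maxsing M" and N: "src.maxsing N" and disj: "M \<inter> N = {}" and p: "p \<in> M"
  obtains x where "is_image M p x" "x \<in> tgt.perp (f (N \<inter> src.perp {p}))"
proof -
  let ?T = "N \<inter> src.perp {p}"
  obtain S where S: "src.submax S" "S \<subseteq> M" "p \<in> S" using src.submax_containing[OF M p] .
  note near = src.near_projection[OF M N disj p]
  have T: "src.submax ?T" using near(1)[OF S(1,2)] .
  have fT: "tgt.submax (f ?T)" "f ?T \<subseteq> g N" using f_submax[OF T] f_subset_g[OF N T] by blast+
  have "tgt.near (f S) (f ?T)" using f_near[OF S(1) T] near(2)[OF S(1,2)] S by blast
  then obtain x where x: "x \<in> f S" "x \<in> tgt.perp (f ?T)" by (auto simp: tgt.near_def)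
  have xM: "x \<in> g M" using x f_subset_g[OF M S(1,2)] by blast
  have "x \<in> f R \<longleftrightarrow> p \<in> R" if R: "src.submax R" "R \<subseteq> M" for R
  proof
    assume "x \<in> f R"
    then have "tgt.near (f R) (f ?T)" using x by (auto simp: tgt.near_def)
    then show "p \<in> R" using f_near[OF R(1) T] near(2)[OF R] by blast
  next
    assume "p \<in> R"
    then have "tgt.near (f R) (f ?T)" using f_near[OF R(1) T] near(2)[OF R] by blast
    then obtain y where y: "y \<in> f R" "y \<in> tgt.perp (f ?T)" by (auto simp: tgt.near_def)
    have "y \<in> g M" using y f_subset_g[OF M R] by blast
    then have "x = y"
      using tgt.unique_perp_of_disjoint[OF g_max[OF M] g_max[OF N] g_disjoint[OF M N disj] fT xM x(2)] y
      by blast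
    then show "x \<in> f R" using y by simp
  qed
  then have "is_image M p x" using xM by (simp add: is_image_def)
  then show thesis using that x by blast
qed

lemma is_image_exists:
  assumes M: "src.maxsing M" and p: "p \<in> M"
  obtains x where "is_image M p x"
proof -
  obtain N where "src.maxsing N" "N \<inter> M = {}"
    using src.maximal_avoiding[OF M src.sing_empty] by blast
  then show thesis using is_image_via_disjoint[OF M _ _ p, of N] that by blast
qed

text \<open>Only the implication from \<open>p \<in> S\<close> to membership in \<open>f S\<close>
  is assumed, which is what the transfer to another maximal subspace delivers. The images of the
  \<open>n - 1\<close> hyperplanes through \<open>p\<close> given by a base containing
  \<open>p\<close> meet in rank at most \<open>1\<close>.\<close>

lemma image_unique:
  assumes M: "src.maxsing M" and p: "p \<in> M"
    and x: "x \<in> g M" "\<And>S. src.submax S \<Longrightarrow> S \<subseteq> M \<Longrightarrow> p \<in> S \<Longrightarrow> x \<in> f S"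
    and y: "y \<in> g M" "\<And>S. src.submax S \<Longrightarrow> S \<subseteq> M \<Longrightarrow> p \<in> S \<Longrightarrow> y \<in> f S"
  shows "x = y"
proof (rule ccontr)
  assume ne: "x \<noteq> y"
  have sM: "src.sing M" using M by (rule src.maxsing_sing)
  have gM: "tgt.sing (g M)" "tgt.rk (g M) = n" using g_max[OF M] by (auto simp: tgt.maxsing_iff_rk)
  have xP: "x \<in> P'" using x(1) tgt.sing_P[OF gM(1)] by blast
  have pP: "p \<in> P" using p src.sing_P[OF sM] by blast
  obtain B where B: "src.indep B" "{p} \<subseteq> B" "src.span B = M"
    using src.base_extend[OF sM src.indep_singleton[OF pP]] p by blast
  have cB: "finite B" "card B = n"
    using B src.rk_span[OF B(1)] M by (auto simp: src.indep_def src.maxsing_iff_rk)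
  define S where "S b = src.span (B - {b})" for b
  have S: "src.submax (S b)" "S b \<subseteq> M" "b \<notin> S b" if "b \<in> B" for b
    using src.base_submax[OF M B(1,3) that] by (simp_all add: S_def)
  have cS: "c \<in> S b" if "c \<in> B" "c \<noteq> b" for b c
    unfolding S_def by (rule src.span_base) (use that in simp)
  define F where "F J = {z \<in> g M. \<forall>b\<in>J. z \<in> f (S b)}" for J
  have F: "tgt.sing (F J) \<and> tgt.rk (F J) + card J \<le> n" if "finite J" "J \<subseteq> B" for J
    using that
  proof (induction J rule: finite_induct)
    case empty
    then show ?case using gM by (simp add: F_def)
  next
    case (insert b J)
    have b: "b \<in> B" and J: "J \<subseteq> B" using insert.prems by auto
    have FJ: "tgt.sing (F J)" "tgt.rk (F J) + card J \<le> n" using insert.IH J by auto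
    have eq: "F (insert b J) = F J \<inter> f (S b)" by (auto simp: F_def)
    have sing: "tgt.sing (F (insert b J))"
      unfolding eq using tgt.sing_Int[OF FJ(1)] f_submax[OF S(1)[OF b]]
      by (simp add: tgt.submax_def tgt.sing_iff)
    have "b \<in> M" using B(3) src.span_base[OF b] by simp
    \<comment> \<open>An image of the base point \<open>b\<close> lies in all previous
      \<open>f (S c)\<close> but not in \<open>f (S b)\<close>, so each new hyperplane lowers the
      rank strictly.\<close>
    then obtain z where z: "is_image M b z" using is_image_exists[OF M] by blast
    have "z \<in> F J"
    proof -
      have "z \<in> f (S c)" if c: "c \<in> J" for c
      proof -
        have "c \<in> B" "b \<noteq> c" using c J insert.hyps by auto
        then show ?thesis using z S[of c] cS[OF b] by (simp add: is_image_def)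
      qed
      then show ?thesis using z by (simp add: F_def is_image_def)
    qed
    moreover have "z \<notin> f (S b)" using z S[OF b] by (simp add: is_image_def)
    ultimately have "F (insert b J) \<subset> F J" unfolding eq by blast
    then have "tgt.rk (F (insert b J)) < tgt.rk (F J)" using tgt.rk_less[OF sing FJ(1)] by blast
    then show ?case using FJ insert.hyps sing by simp
  qed
  let ?J = "B - {p}"
  have r: "tgt.sing (F ?J)" "tgt.rk (F ?J) + card ?J \<le> n" using F[of ?J] cB by auto
  have "card ?J = n - 1" using cB B by simp
  then have r1: "tgt.rk (F ?J) \<le> 1" using r src.rank_ge_2 by simp
  have "p \<in> S b" if "b \<in> ?J" for b using cS[of p b] B(2) that by blast
  then have "x \<in> F ?J" "y \<in> F ?J"
    using x y S by (simp_all add: F_def)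
  then have "{x} \<subset> F ?J" using ne by (intro psubsetI) auto
  then have "1 < tgt.rk (F ?J)"
    using tgt.rk_less[OF tgt.sing_singleton[OF xP] r(1)] tgt.rk_singleton[OF xP] by simp
  then show False using r1 by simp
qed

text \<open>For \<open>V\<close> in \<open>K\<close> through \<open>p\<close>, a quadrangle supplies
  \<open>U\<close> in \<open>M\<close> through \<open>p\<close>; its image is again such a
  quadrangle, so \<open>x\<close>, lying in \<open>f U\<close> and \<open>f (M \<inter> K)\<close>,
  lies in \<open>f V\<close>. \<open>image_unique\<close> gives the converse incidences.\<close>

lemma is_image_step:
  assumes M: "src.maxsing M" and K: "src.maxsing K" and S: "src.submax (M \<inter> K)"
    and p: "p \<in> M" "p \<in> K" and x: "is_image M p x"
  shows "is_image K p x"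
proof -
  have xS: "x \<in> f (M \<inter> K)" using x S p by (auto simp: is_image_def)
  then have xK: "x \<in> g K" using f_subset_g[OF K S] by blast
  have "x \<in> f V" if V: "src.submax V" "V \<subseteq> K" "p \<in> V" for V
  proof (cases "V = M \<inter> K")
    case True then show ?thesis using xS by simp
  next
    case False
    obtain U W where UW: "U \<subseteq> M" "p \<in> U" "(U, M \<inter> K) \<in> src.adj" "(M \<inter> K, V) \<in> src.adj"
      "(V, W) \<in> src.adj" "(W, U) \<in> src.adj" "(M \<inter> K, W) \<notin> src.adj" "M \<inter> K \<noteq> W"
      by (rule src.quadrangle_exists[OF M K S V(1,2) False V(3) p(1)])
    have sub: "src.submax U" "src.submax W" using UW by (auto simp: src.adj_iff)
    have "f U \<inter> f (M \<inter> K) \<subseteq> f V"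
    proof (rule tgt.quadrangle_Int)
      show "f (M \<inter> K) \<noteq> f W" using f_inj[OF S sub(2)] UW by blast
    qed (use UW f_adj sub S V in simp_all)
    moreover have "x \<in> f U" using x UW sub by (simp add: is_image_def)
    ultimately show ?thesis using xS by blast
  qed
  moreover obtain y where y: "is_image K p y" using is_image_exists[OF K p(2)] .
  ultimately have "x = y" using image_unique[OF K p(2) xK, of y] by (simp add: is_image_def)
  then show ?thesis using y by simp
qed

text \<open>The path from \<open>M\<close> to \<open>K\<close> made of dual steps keeps
  \<open>M \<inter> K\<close>, and with it \<open>p\<close>, in every member.\<close>

lemma is_image_transfer:
  assumes K: "src.maxsing K" "p \<in> K"
  shows "\<lbrakk>src.maxsing M; p \<in> M; is_image M p x\<rbrakk> \<Longrightarrow> is_image K p x"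
proof (induction "n - src.rk (M \<inter> K)" arbitrary: M rule: less_induct)
  case less
  show ?case
  proof (cases "M = K")
    case True then show ?thesis using less.prems by simp
  next
    case False
    obtain M' where M': "src.maxsing M'" "src.submax (M \<inter> M')" "M \<inter> K \<subseteq> M'"
      "src.rk (M \<inter> K) < src.rk (M' \<inter> K)"
      using src.dual_step[OF less.prems(1) K(1) False] by blast
    have p: "p \<in> M'" using M' less.prems K by blast
    have "src.sing (M' \<inter> K)" using M' K src.maxsing_sing src.sing_Int by (simp add: src.sing_iff)
    then have "src.rk (M' \<inter> K) \<le> n" by (rule src.rk_le)
    then have "n - src.rk (M' \<inter> K) < n - src.rk (M \<inter> K)" using M' by simp
    then show ?thesis
      using less.hyps[OF _ M'(1) p is_image_step[OF less.prems(1) M'(1,2) less.prems(2) p less.prems(3)]]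
      by blast
  qed
qed

section \<open>The point map and its properties\<close>

definition h :: "'a \<Rightarrow> 'b" where
  "h p = (SOME x. \<forall>M. src.maxsing M \<longrightarrow> p \<in> M \<longrightarrow> is_image M p x)"

lemma h_image:
  assumes "src.maxsing M" "p \<in> M" shows "is_image M p (h p)"
proof -
  obtain x where "is_image M p x" using is_image_exists[OF assms] .
  then have "\<forall>K. src.maxsing K \<longrightarrow> p \<in> K \<longrightarrow> is_image K p x" using is_image_transfer assms by blast
  then show ?thesis
    unfolding h_def using someI_ex[of "\<lambda>x. \<forall>M. src.maxsing M \<longrightarrow> p \<in> M \<longrightarrow> is_image M p x"] assms
    by blast
qed

lemma h_in_g: "src.maxsing M \<Longrightarrow> p \<in> M \<Longrightarrow> h p \<in> g M"
  using h_image by (simp add: is_image_def)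

lemma h_in_f_iff: "src.maxsing M \<Longrightarrow> p \<in> M \<Longrightarrow> src.submax S \<Longrightarrow> S \<subseteq> M \<Longrightarrow> h p \<in> f S \<longleftrightarrow> p \<in> S"
  using h_image by (simp add: is_image_def)

text \<open>\<open>h\<close> maps a base of a maximal subspace through \<open>U\<close> to an
  independent set. Hence the image of a base of \<open>U\<close> spans a subspace of
  \<open>f U\<close> of full rank \<open>n - 1\<close>.\<close>

lemma f_eq_span:
  assumes U: "src.submax U"
  shows "f U = tgt.span (h ` U)"
proof -
  have sU: "src.sing U" "src.rk U = n - 1" using U by (auto simp: src.submax_def)
  have fU: "tgt.sing (f U)" "tgt.rk (f U) = n - 1" using f_submax[OF U] by (auto simp: tgt.submax_def)
  obtain M where M: "src.maxsing M" "U \<subseteq> M" using src.maximal_of_submax[OF U] .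
  have sM: "src.sing M" by (rule src.maxsing_sing[OF M(1)])
  obtain B where B: "src.indep B" "src.span B = U" "card B = n - 1"
    using src.obtain_base[OF sU(1)] sU(2) by metis
  have BU: "B \<subseteq> U" using pls_span_superset[of B P L] B by simp
  then have "B \<subseteq> M" using M by blast
  then obtain C where C: "src.indep C" "B \<subseteq> C" "src.span C = M"
    using src.base_extend[OF sM B(1)] by blast
  have CM: "C \<subseteq> M" using pls_span_superset[of C P L] C by simp
  have "tgt.indep (h ` J) \<and> card (h ` J) = card J" if "finite J" "J \<subseteq> C" for J
    using that
  proof (induction J rule: finite_induct)
    case empty
    then show ?case by (simp add: tgt.indep_empty)
  next
    case (insert b J)
    have b: "b \<in> C" "b \<in> M" and J: "J \<subseteq> C" "J \<subseteq> M" using insert.prems CM by auto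
    note S = src.base_submax[OF M(1) C(1,3) b(1)]
    let ?S = "src.span (C - {b})"
    \<comment> \<open>The image under \<open>f\<close> of the hyperplane spanned by the other base
      points contains \<open>h c\<close> for these, but not \<open>h b\<close>.\<close>
    have "h ` J \<subseteq> f ?S"
    proof
      fix z assume "z \<in> h ` J"
      then obtain c where c: "c \<in> J" "z = h c" by blast
      then have "c \<in> ?S" using J insert.hyps by (intro src.span_base) auto
      then show "z \<in> f ?S" using h_in_f_iff[OF M(1) _ S(1,2), of c] c J by auto
    qed
    then have "tgt.span (h ` J) \<subseteq> f ?S"
      using tgt.span_subset_sing f_submax[OF S(1)] by (simp add: tgt.submax_def)
    moreover have "h b \<notin> f ?S" using h_in_f_iff[OF M(1) b(2) S(1,2)] S(3) by simp
    ultimately have nb: "h b \<notin> tgt.span (h ` J)" by blast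
    have "h ` J \<subseteq> g M" using h_in_g[OF M(1)] J by blast
    then have "h b \<in> tgt.perp (h ` J)" using g_perp[OF M(1)] h_in_g[OF M(1) b(2)] by blast
    then have "tgt.indep (insert (h b) (h ` J))" using tgt.indep_insert nb insert.IH J by blast
    moreover have "h b \<notin> h ` J" using nb tgt.span_base[of "h b" "h ` J"] by blast
    ultimately show ?case using insert J by simp
  qed
  then have i: "tgt.indep (h ` B)" "card (h ` B) = n - 1" using B C by (auto simp: src.indep_def)
  have "h ` U \<subseteq> f U" using h_in_f_iff[OF M(1) _ U M(2)] M by blast
  then have le: "tgt.span (h ` U) \<subseteq> f U" by (rule tgt.span_subset_sing[OF fU(1)])
  have le': "tgt.span (h ` B) \<subseteq> tgt.span (h ` U)" using BU by (intro pls_span_mono) blast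
  have "tgt.sing (tgt.span (h ` B))" using i tgt.clique_span by (simp add: tgt.indep_def)
  then have "tgt.span (h ` B) = f U"
    using tgt.eq_if_rk_le[OF _ fU(1)] le le' tgt.rk_span[OF i(1)] i fU by simp
  then show ?thesis using le le' by blast
qed

lemma h_collinear:
  assumes p: "p \<in> P" and q: "q \<in> P" and col: "src.col p q"
  shows "tgt.col (h p) (h q)" "p \<noteq> q \<Longrightarrow> h p \<noteq> h q"
proof -
  have "q \<in> src.perp {p}" using q col by (simp add: src.perp_def)
  then obtain M where M: "src.maxsing M" "p \<in> M" "q \<in> M"
    using src.maximal_through[OF src.sing_singleton[OF p]] by blast
  show "tgt.col (h p) (h q)"
    using tgt.sing_col[OF tgt.maxsing_sing[OF g_max[OF M(1)]]] h_in_g[OF M(1)] M by blast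
  assume "p \<noteq> q"
  then obtain S where S: "src.submax S" "S \<subseteq> M" "p \<in> S" "q \<notin> S"
    using src.submax_separating_points[OF M] by blast
  then show "h p \<noteq> h q" using h_in_f_iff[OF M(1) _ S(1,2)] M by metis
qed

text \<open>For disjoint maximal subspaces through \<open>p\<close> and \<open>q\<close>, the point
  \<open>h p\<close> is collinear with the image of the projection of \<open>p\<close>, while
  \<open>h q\<close> lies in \<open>g N\<close> outside it. Collinearity of \<open>h p\<close> and
  \<open>h q\<close> would force \<open>h p\<close> into \<open>g N\<close>.\<close>

lemma h_not_collinear:
  assumes p: "p \<in> P" and q: "q \<in> P" and ncol: "\<not> src.col p q"
  shows "\<not> tgt.col (h p) (h q)"
proof
  assume c: "tgt.col (h p) (h q)"
  obtain M where M: "src.maxsing M" "p \<in> M" using src.maximal_through_point[OF p] .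
  have qM: "q \<notin> M" using src.sing_col[OF src.maxsing_sing[OF M(1)] M(2)] ncol by blast
  obtain N where N: "src.maxsing N" "q \<in> N" "M \<inter> N = {}"
    using src.disjoint_maximal_through[OF M(1) q qM] .
  let ?T = "N \<inter> src.perp {p}"
  obtain S where S: "src.submax S" "S \<subseteq> M" "p \<in> S" using src.submax_containing[OF M] .
  have T: "src.submax ?T" using src.near_projection(1)[OF M(1) N(1,3) M(2) S(1,2)] .
  obtain x where x: "is_image M p x" "x \<in> tgt.perp (f ?T)"
    using is_image_via_disjoint[OF M(1) N(1,3) M(2)] .
  have "x = h p"
    using image_unique[OF M, of x "h p"] x(1) h_image[OF M] by (simp add: is_image_def)
  then have hp: "h p \<in> tgt.perp (f ?T)" using x by simp
  have "q \<notin> ?T" using ncol by (simp add: src.perp_def)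
  then have hq: "h q \<notin> f ?T" using h_in_f_iff[OF N(1,2) T] by blast
  have "f ?T \<subseteq> g N" using f_subset_g[OF N(1) T] by blast
  then have "h p \<in> g N"
    using tgt.in_max_if_perp[OF g_max[OF N(1)] f_submax[OF T] _ h_in_g[OF N(1,2)] hq hp]
      tgt.col_sym[OF c] by blast
  then show False using g_disjoint[OF M(1) N(1,3)] h_in_g[OF M] by blast
qed

lemma h_in_P': assumes "p \<in> P" shows "h p \<in> P'"
proof -
  obtain M where M: "src.maxsing M" "p \<in> M" using src.maximal_through_point[OF assms] .
  show ?thesis using tgt.maxsing_P[OF g_max[OF M(1)]] h_in_g[OF M] by (rule subsetD)
qed

lemma induced_by_injection:
  "\<exists>h. collinearity_preserving_injection P L P' L' h \<and>
       induced_by (polar_grassmannian P L (n - 2)) P' L' f h"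
proof (intro exI conjI)
  have "inj_on h P"
  proof (rule inj_onI)
    fix p q assume pq: "p \<in> P" "q \<in> P" "h p = h q"
    show "p = q"
    proof (cases "src.col p q")
      case True
      then show ?thesis using h_collinear(2) pq by blast
    next
      case False
      \<comment> \<open>Equal images are collinear, since each point is collinear with
        itself.\<close>
      then show ?thesis using h_not_collinear pq tgt.col_refl[OF h_in_P'] by metis
    qed
  qed
  moreover have "src.col p q = tgt.col (h p) (h q)" if "p \<in> P" "q \<in> P" for p q
    using h_collinear(1) h_not_collinear that by blast
  ultimately show "collinearity_preserving_injection P L P' L' h"
    using h_in_P' by (auto simp: collinearity_preserving_injection_def)
  show "induced_by (polar_grassmannian P L (n - 2)) P' L' f h"
    using f_eq_span by (simp add: induced_by_def src.grassmannian_submax)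
qed

end

subsection \<open>Polar spaces and thin polar spaces\<close>

lemma polar_geometry_if_polar_space:
  assumes "2 \<le> n" "polar_space_of_rank P L n"
  shows "polar_geometry P L n"
proof
  have ps: "polar_space P L"
    and max: "\<forall>M. maximal_singular_subspace P L M \<longrightarrow> singular_subspace_of_dim P L (n - 1) M"
    using assms(2) by (simp_all add: polar_space_of_rank_def)
  show "partial_linear_space P L" using ps by (simp add: polar_space_def)
  show "2 \<le> n" by (rule assms)
  show "\<exists>q\<in>P. \<not> pls_collinear L p q" if "p \<in> P" for p
    using ps that by (simp add: polar_space_def)
  show "(\<exists>!q. q \<in> l \<and> pls_collinear L p q) \<or> (\<forall>q\<in>l. pls_collinear L p q)"
    if "p \<in> P" "l \<in> L" for p l
    using ps that by (simp add: polar_space_def)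
  show "singular_subspace_of_dim P L (n - 1) M" if "maximal_singular_subspace P L M" for M
    using max that by blast
qed

lemma pls_subspace_if_thin_lines:
  assumes "\<And>l. l \<in> L \<Longrightarrow> \<exists>x y. l = {x, y}" "X \<subseteq> P"
  shows "pls_subspace P L X"
  unfolding pls_subspace_def
proof (intro conjI ballI impI)
  fix p q l assume "p \<in> X" "q \<in> X" "p \<noteq> q" "l \<in> L" "p \<in> l \<and> q \<in> l"
  moreover obtain x y where "l = {x, y}" using assms(1) \<open>l \<in> L\<close> by blast
  ultimately show "l \<subseteq> X" by auto
qed (rule assms)

lemma pls_independent_if_thin_lines:
  assumes "\<And>l. l \<in> L \<Longrightarrow> \<exists>x y. l = {x, y}" "X \<subseteq> P"
  shows "pls_independent P L X"
  unfolding pls_independent_def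
proof (intro conjI allI impI)
  fix Y assume "Y \<subset> X"
  then show "pls_span P L Y \<noteq> pls_span P L X"
    using pls_span_subspace_eq[OF pls_subspace_if_thin_lines[OF assms(1)]] assms(2) by auto
qed (rule assms)

lemma thin_points_uminus: "- i \<in> thin_points n \<longleftrightarrow> i \<in> thin_points n"
  by (auto simp: thin_points_def)

text \<open>\<open>X\<close> contains exactly one of \<open>i\<close> and \<open>- i\<close> for
  each \<open>i\<close>, so the absolute value maps it bijectively onto
  \<open>{1..int n}\<close>.\<close>

lemma card_thin_clique:
  assumes X: "X \<subseteq> thin_points n"
    and one: "\<And>i. i \<in> thin_points n \<Longrightarrow> i \<in> X \<longleftrightarrow> - i \<notin> X"
  shows "card X = n"
proof -
  have "bij_betw abs X {1..int n}"
  proof (rule bij_betw_imageI)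
    show "inj_on abs X"
    proof (rule inj_onI)
      fix x y assume "x \<in> X" "y \<in> X" "\<bar>x\<bar> = \<bar>y\<bar>"
      then show "x = y" using one[of x] X by (auto simp: abs_eq_iff)
    qed
    show "abs ` X = {1..int n}"
    proof
      show "abs ` X \<subseteq> {1..int n}" using X by (auto simp: thin_points_def)
      show "{1..int n} \<subseteq> abs ` X"
      proof
        fix i assume i: "i \<in> {1..int n}"
        then have "i \<in> thin_points n" by (simp add: thin_points_def)
        then have "i \<in> X \<or> - i \<in> X" using one by blast
        moreover have "i = \<bar>i\<bar>" "i = \<bar>- i\<bar>" using i by auto
        ultimately show "i \<in> abs ` X" by blast
      qed
    qed
  qed
  then show ?thesis by (simp add: bij_betw_same_card)
qed

lemma polar_geometry_if_thin:
  assumes n: "2 \<le> n" and thin: "thin_polar_space_of_rank P L n"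
  shows "polar_geometry P L n"
proof -
  have pls: "partial_linear_space P L" using thin by (simp add: thin_polar_space_of_rank_def)
  obtain \<phi> where bij: "bij_betw \<phi> (thin_points n) P" and L: "(\<lambda>l. \<phi> ` l) ` thin_lines n = L"
    using thin unfolding thin_polar_space_of_rank_def pls_isomorphic_def by blast
  have inj: "inj_on \<phi> (thin_points n)" and P: "\<phi> ` thin_points n = P"
    using bij by (auto simp: bij_betw_def)
  have line: "l \<in> L \<longleftrightarrow> (\<exists>i j. i \<in> thin_points n \<and> j \<in> thin_points n \<and> i \<noteq> j \<and> j \<noteq> - i \<and> l = {\<phi> i, \<phi> j})" for l
    unfolding L[symmetric] thin_lines_def image_iff by auto
  have two: "\<exists>x y. l = {x, y}" if "l \<in> L" for l using that line by blast
  note subsp = pls_subspace_if_thin_lines[OF two]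
  have eq: "\<phi> i = \<phi> j \<longleftrightarrow> i = j" if "i \<in> thin_points n" "j \<in> thin_points n" for i j
    using inj that by (simp add: inj_on_eq_iff)
  \<comment> \<open>The case \<open>i = j\<close> obeys the same formula, because \<open>0\<close>
    is not a point and so \<open>i \<noteq> - i\<close>.\<close>
  have col: "pls_collinear L (\<phi> i) (\<phi> j) \<longleftrightarrow> j \<noteq> - i"
    if i: "i \<in> thin_points n" and j: "j \<in> thin_points n" for i j
  proof
    assume "pls_collinear L (\<phi> i) (\<phi> j)"
    then obtain l where l: "l \<in> L" "\<phi> i \<in> l" "\<phi> j \<in> l"
      unfolding pls_collinear_def by blast
    obtain a b where "a \<in> thin_points n \<and> b \<in> thin_points n \<and> a \<noteq> b \<and> b \<noteq> - a \<and> l = {\<phi> a, \<phi> b}"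
      using line[of l] l(1) by blast
    then have ab: "a \<in> thin_points n" "b \<in> thin_points n" "b \<noteq> - a"
      "\<phi> i \<in> {\<phi> a, \<phi> b}" "\<phi> j \<in> {\<phi> a, \<phi> b}"
      using l by auto
    have "i = a \<or> i = b" "j = a \<or> j = b" using ab eq i j by auto
    moreover have "a \<noteq> - a" "b \<noteq> - b" using ab by (auto simp: thin_points_def)
    ultimately show "j \<noteq> - i" using ab(3) by auto
  next
    assume ne: "j \<noteq> - i"
    show "pls_collinear L (\<phi> i) (\<phi> j)"
    proof (cases "i = j")
      case True
      then show ?thesis
        using pls P i unfolding partial_linear_space_def pls_collinear_def by blast
    next
      case False
      then have "{\<phi> i, \<phi> j} \<in> L" using line i j ne by blast
      then show ?thesis unfolding pls_collinear_def by blast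
    qed
  qed
  show ?thesis
  proof
    show "partial_linear_space P L" by (rule pls)
    show "2 \<le> n" by (rule n)
  next
    fix p assume "p \<in> P"
    then obtain i where i: "i \<in> thin_points n" "p = \<phi> i" using P by blast
    have "\<phi> (- i) \<in> P" using P i thin_points_uminus by blast
    moreover have "\<not> pls_collinear L p (\<phi> (- i))" using col[of i "- i"] i thin_points_uminus by simp
    ultimately show "\<exists>q\<in>P. \<not> pls_collinear L p q" by blast
  next
    fix p l assume "p \<in> P" "l \<in> L"
    obtain k where k: "k \<in> thin_points n" "p = \<phi> k" using \<open>p \<in> P\<close> P by blast
    obtain i j where ij: "i \<in> thin_points n" "j \<in> thin_points n" "i \<noteq> j" "l = {\<phi> i, \<phi> j}"
      using line[of l] \<open>l \<in> L\<close> by auto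
    \<comment> \<open>\<open>- k\<close> cannot equal both \<open>i\<close> and \<open>j\<close>. As
      the line consists of two points, one collinear point already yields one of the two
      alternatives.\<close>
    have "pls_collinear L p (\<phi> i) \<or> pls_collinear L p (\<phi> j)"
      using col[OF k(1) ij(1)] col[OF k(1) ij(2)] k ij by auto
    then show "(\<exists>!q. q \<in> l \<and> pls_collinear L p q) \<or> (\<forall>q\<in>l. pls_collinear L p q)"
      unfolding ij(4) by auto
  next
    fix M assume max: "maximal_singular_subspace P L M"
    then have sM: "singular_subspace P L M" by (simp add: maximal_singular_subspace_def)
    then have MP: "M \<subseteq> P" by (simp add: singular_subspace_def pls_subspace_def)
    define X where "X = {i \<in> thin_points n. \<phi> i \<in> M}"
    have X: "X \<subseteq> thin_points n" by (auto simp: X_def)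
    have MX: "M = \<phi> ` X" using MP P by (auto simp: X_def)
    \<comment> \<open>By maximality \<open>M\<close> omits a point only if its opposite belongs to
      \<open>M\<close>: otherwise the point could be adjoined.\<close>
    have one: "i \<in> X \<longleftrightarrow> - i \<notin> X" if i: "i \<in> thin_points n" for i
    proof
      assume iX: "i \<in> X"
      show "- i \<notin> X"
      proof
        assume "- i \<in> X"
        moreover have "\<phi> i \<noteq> \<phi> (- i)" using eq[of i "- i"] i thin_points_uminus by (auto simp: thin_points_def)
        ultimately have "pls_collinear L (\<phi> i) (\<phi> (- i))"
          using sM iX by (simp add: singular_subspace_def X_def)
        then show False using col[of i "- i"] i thin_points_uminus by simp
      qed
    next
      assume nX: "- i \<notin> X"
      have c: "pls_collinear L (\<phi> i) q \<and> pls_collinear L q (\<phi> i)" if q: "q \<in> M" for q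
      proof -
        obtain j where j: "j \<in> X" "q = \<phi> j" using q MX by blast
        then have "j \<noteq> - i" "i \<noteq> - j" using nX by auto
        then show ?thesis using col i j X by blast
      qed
      have "insert (\<phi> i) M \<subseteq> P" using MP P i by blast
      moreover have "\<forall>p\<in>insert (\<phi> i) M. \<forall>q\<in>insert (\<phi> i) M. p \<noteq> q \<longrightarrow> pls_collinear L p q"
        using sM c by (simp add: singular_subspace_def)
      ultimately have "singular_subspace P L (insert (\<phi> i) M)"
        using subsp by (simp add: singular_subspace_def)
      then have "insert (\<phi> i) M = M" using max unfolding maximal_singular_subspace_def by blast
      then show "i \<in> X" using i by (auto simp: X_def)
    qed
    have "card X = n" by (rule card_thin_clique[OF X one])
    then have "card M = n" unfolding MX using card_image[OF inj_on_subset[OF inj X]] by simp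
    \<comment> \<open>An infinite set has cardinality \<open>0\<close>, so \<open>n \<ge> 2\<close>
      yields finiteness.\<close>
    then have cM: "finite M" "card M = n - 1 + 1" using n card.infinite by fastforce+
    have "pls_span P L M = M" using pls_span_subspace_eq[OF subsp[OF _ MP]] by blast
    moreover have "pls_independent P L M" using pls_independent_if_thin_lines[OF two MP] by blast
    ultimately show "singular_subspace_of_dim P L (n - 1) M"
      using sM cM unfolding singular_subspace_of_dim_def by blast
  qed
qed

theorem theorem3:
  fixes P :: "'a set" and L :: "'a set set"
    and P' :: "'b set" and L' :: "'b set set"
    and n :: nat and f :: "'a set \<Rightarrow> 'b set"
  assumes "n \<ge> 2"
    and "polar_space_of_rank P L n \<or> thin_polar_space_of_rank P L n"
    and "polar_space_of_rank P' L' n"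
    and "isometric_embedding
           (polar_grassmannian P L (n - 2)) (polar_grassmann_adj P L n)
           (polar_grassmannian P' L' (n - 2)) (polar_grassmann_adj P' L' n) f"
  shows "\<exists>h. collinearity_preserving_injection P L P' L' h \<and>
             induced_by (polar_grassmannian P L (n - 2)) P' L' f h"
proof -
  have "polar_geometry P L n"
    using assms(1,2) polar_geometry_if_polar_space polar_geometry_if_thin by blast
  moreover have "polar_geometry P' L' n"
    using assms(1,3) by (rule polar_geometry_if_polar_space)
  ultimately have "polar_embedding P L P' L' n f"
    using assms(4) by (simp add: polar_embedding_def polar_embedding_axioms_def)
  then show ?thesis by (rule polar_embedding.induced_by_injection)
qed

end
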